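(* Let $M$ be a countably infinite set-homogeneous a-digraph which is not $2$-homogeneous. Then $M$ is isomorphic to $T(4)$ or to $R_n$ for some $n$ with $2\le n\le\aleph_0$.
   Context: An a-digraph is a set with an irreflexive antisymmetric binary relation $\to$. It is set-homogeneous if whenever $U,V$ are isomorphic finite induced subdigraphs there is an automorphism $g$ with $U^g=V$; it is $k$-homogeneous if every isomorphism between induced subdigraphs of size $k$ extends to an automorphism. $T(4)$ is the a-digraph (unique up to isomorphism) whose vertex set is a countable dense set of points on the unit circle, no two making an angle of $\pi/2$ or $\pi$ at the centre, with $y\to x$ iff $\pi/2<\arg(y/x)<\pi$ (argument taken in $[0,2\pi)$). For $2\le n\le\aleph_0$, let $\{Q_i:0\le i<n\}$ be a partition of $\mathbb{Q}$ into $n$ dense codense subsets; $R_n$ is the a-digraph (unique up to isomorphism) on $\mathbb{Q}$ with $a\to b$ iff $a<b$ and there is no $i$ with $a,b\in Q_i$. *)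

theory Defs
  imports "HOL-Analysis.Complex_Transcendental" "HOL-Library.Extended_Nat" "HOL-Library.Disjoint_Sets"
begin

definition a_digraph :: "'a set \<Rightarrow> 'a rel \<Rightarrow> bool" where
  "a_digraph V R \<longleftrightarrow> R \<subseteq> V \<times> V \<and> irrefl R \<and> antisym R"

definition digraph_iso :: "'a set \<Rightarrow> 'a rel \<Rightarrow> 'b set \<Rightarrow> 'b rel \<Rightarrow> ('a \<Rightarrow> 'b) \<Rightarrow> bool" where
  "digraph_iso V R W S f \<longleftrightarrow>
     bij_betw f V W \<and> (\<forall>x\<in>V. \<forall>y\<in>V. (x, y) \<in> R \<longleftrightarrow> (f x, f y) \<in> S)"

definition isomorphic_digraphs :: "'a set \<Rightarrow> 'a rel \<Rightarrow> 'b set \<Rightarrow> 'b rel \<Rightarrow> bool" where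
  "isomorphic_digraphs V R W S \<longleftrightarrow> (\<exists>f. digraph_iso V R W S f)"

definition digraph_aut :: "'a set \<Rightarrow> 'a rel \<Rightarrow> ('a \<Rightarrow> 'a) \<Rightarrow> bool" where
  "digraph_aut V R g \<longleftrightarrow> digraph_iso V R V R g"

text \<open>The induced subdigraph on \<open>U\<close> is given by \<open>U\<close> and \<open>Restr R U\<close>, that is \<open>R \<inter> U \<times> U\<close>.\<close>

definition set_homogeneous :: "'a set \<Rightarrow> 'a rel \<Rightarrow> bool" where
  "set_homogeneous V R \<longleftrightarrow>
     (\<forall>U W. U \<subseteq> V \<and> W \<subseteq> V \<and> finite U \<and> finite W \<and>
        isomorphic_digraphs U (Restr R U) W (Restr R W)
        \<longrightarrow> (\<exists>g. digraph_aut V R g \<and> g ` U = W))"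

definition k_homogeneous :: "nat \<Rightarrow> 'a set \<Rightarrow> 'a rel \<Rightarrow> bool" where
  "k_homogeneous k V R \<longleftrightarrow>
     (\<forall>U W f. U \<subseteq> V \<and> W \<subseteq> V \<and> finite U \<and> finite W \<and> card U = k \<and> card W = k \<and>
        digraph_iso U (Restr R U) W (Restr R W) f
        \<longrightarrow> (\<exists>g. digraph_aut V R g \<and> (\<forall>x\<in>U. g x = f x)))"

text \<open>\<open>Arg2pi\<close> takes values in \<open>[0, 2\<pi>)\<close>. As \<open>x\<close> and \<open>y\<close> range over ordered pairs, the last
  condition also excludes \<open>Arg2pi (y / x) = 3\<pi>/2\<close>.\<close>

definition T4_vertices :: "complex set \<Rightarrow> bool" where
  "T4_vertices S \<longleftrightarrow>
     countable S \<and> S \<subseteq> sphere 0 1 \<and> sphere 0 1 \<subseteq> closure S \<and>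
     (\<forall>x\<in>S. \<forall>y\<in>S. Arg2pi (y / x) \<noteq> pi / 2 \<and> Arg2pi (y / x) \<noteq> pi)"

definition T4_rel :: "complex set \<Rightarrow> complex rel" where
  "T4_rel S = {(y, x). y \<in> S \<and> x \<in> S \<and> pi / 2 < Arg2pi (y / x) \<and> Arg2pi (y / x) < pi}"

text \<open>\<open>T(4)\<close> is determined up to isomorphism only, independently of the choice of the vertex set.\<close>

definition is_T4 :: "'a set \<Rightarrow> 'a rel \<Rightarrow> bool" where
  "is_T4 V R \<longleftrightarrow> (\<exists>S. T4_vertices S \<and> isomorphic_digraphs V R S (T4_rel S))"

definition dense_in_rat :: "rat set \<Rightarrow> bool" where
  "dense_in_rat A \<longleftrightarrow> (\<forall>a b. a < b \<longrightarrow> (\<exists>c\<in>A. a < c \<and> c < b))"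

text \<open>The number of parts is an extended natural number, \<open>\<infinity>\<close> standing for \<open>\<aleph>\<^sub>0\<close>;
  only the values \<open>Q i\<close> with \<open>enat i < n\<close> matter.\<close>

definition dense_codense_partition :: "enat \<Rightarrow> (nat \<Rightarrow> rat set) \<Rightarrow> bool" where
  "dense_codense_partition n Q \<longleftrightarrow>
     disjoint_family_on Q {i. enat i < n} \<and> (\<Union>i\<in>{i. enat i < n}. Q i) = UNIV \<and>
     (\<forall>i. enat i < n \<longrightarrow> dense_in_rat (Q i) \<and> dense_in_rat (- Q i))"

definition R_rel :: "enat \<Rightarrow> (nat \<Rightarrow> rat set) \<Rightarrow> rat rel" where
  "R_rel n Q = {(a, b). a < b \<and> \<not> (\<exists>i. enat i < n \<and> a \<in> Q i \<and> b \<in> Q i)}"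

text \<open>\<open>R\<^sub>n\<close> is determined up to isomorphism only, independently of the choice of the partition.\<close>

definition is_R :: "enat \<Rightarrow> 'a set \<Rightarrow> 'a rel \<Rightarrow> bool" where
  "is_R n V R \<longleftrightarrow>
     (\<exists>Q. dense_codense_partition n Q \<and> isomorphic_digraphs V R UNIV (R_rel n Q))"

end

theory Submission
  imports Defs
begin

text \<open>If \<open>2\<close>-homogeneity fails, no automorphism swaps an unrelated pair, so the automorphism group
  (of the arc relation \<open>\<leadsto>\<close>) orients the unrelated pairs by an invariant relation \<open>\<Rrightarrow>\<close>. Set-homogeneity forces each finite
  induced subdigraph to carry \<open>\<Rrightarrow>\<close> in only one way, which restricts the configurations of three
  points severely. If no vertex is unrelated to both ends of an arc, unrelatedness is an equivalence
  relation, the union of \<open>\<leadsto>\<close> and \<open>\<Rrightarrow>\<close> is a dense linear order in which every class is dense, and the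
  digraph is some \<open>R\<^sub>n\<close>. Otherwise any vertex \<open>c\<close> unrelated to both ends of an arc \<open>a \<leadsto> b\<close>
  satisfies \<open>b \<Rrightarrow> c \<Rrightarrow> a\<close> (for a suitable orientation), and the four possible relations of \<open>y\<close> to \<open>x\<close>
  behave like the quadrant in which \<open>y\<close> is seen from \<open>x\<close> on a circle: the quadrants of two
  successive steps add up modulo \<open>4\<close> with a carry of \<open>0\<close> or \<open>1\<close>. The carry orders the vertices other
  than a base point, and Cantor's theorem places them on the circle.\<close>

subsection \<open>Cantor's isomorphism theorem\<close>

definition dense_unbounded_order :: "'a set \<Rightarrow> ('a \<Rightarrow> 'a \<Rightarrow> bool) \<Rightarrow> bool" where
  "dense_unbounded_order A lt \<longleftrightarrow> A \<noteq> {} \<and>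
     (\<forall>x\<in>A. \<not> lt x x) \<and>
     (\<forall>x\<in>A. \<forall>y\<in>A. \<forall>z\<in>A. lt x y \<longrightarrow> lt y z \<longrightarrow> lt x z) \<and>
     (\<forall>x\<in>A. \<forall>y\<in>A. x \<noteq> y \<longrightarrow> lt x y \<or> lt y x) \<and>
     (\<forall>x\<in>A. \<forall>y\<in>A. lt x y \<longrightarrow> (\<exists>z\<in>A. lt x z \<and> lt z y)) \<and>
     (\<forall>x\<in>A. \<exists>y\<in>A. lt x y) \<and> (\<forall>x\<in>A. \<exists>y\<in>A. lt y x)"

lemma dense_unbounded_orderD:
  assumes "dense_unbounded_order A lt"
  shows "A \<noteq> {}" "\<And>x. x \<in> A \<Longrightarrow> \<not> lt x x"
    "\<And>x y z. x \<in> A \<Longrightarrow> y \<in> A \<Longrightarrow> z \<in> A \<Longrightarrow> lt x y \<Longrightarrow> lt y z \<Longrightarrow> lt x z"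
    "\<And>x y. x \<in> A \<Longrightarrow> y \<in> A \<Longrightarrow> x \<noteq> y \<Longrightarrow> lt x y \<or> lt y x"
    "\<And>x y. x \<in> A \<Longrightarrow> y \<in> A \<Longrightarrow> lt x y \<Longrightarrow> \<exists>z\<in>A. lt x z \<and> lt z y"
    "\<And>x. x \<in> A \<Longrightarrow> \<exists>y\<in>A. lt x y" "\<And>x. x \<in> A \<Longrightarrow> \<exists>y\<in>A. lt y x"
  using assms unfolding dense_unbounded_order_def by meson+

lemma dense_unbounded_order_rat: "dense_unbounded_order (UNIV :: rat set) (<)"
  unfolding dense_unbounded_order_def
  by (intro conjI ballI impI) (auto simp: dense gt_ex lt_ex)

lemma dense_unbounded_order_rat_unit: "dense_unbounded_order {0<..<1::rat} (<)"
  unfolding dense_unbounded_order_def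
proof (intro conjI ballI impI)
  show "{0<..<1::rat} \<noteq> {}" by (simp add: dense)
next
  fix x :: rat assume "x \<in> {0<..<1}"
  then show "\<exists>y\<in>{0<..<1}. x < y" "\<exists>y\<in>{0<..<1}. y < x"
    using dense[of x 1] dense[of 0 x] by (meson greaterThanLessThan_iff less_trans)+
next
  fix x y :: rat assume "x \<in> {0<..<1}" "y \<in> {0<..<1}" "x < y"
  then show "\<exists>z\<in>{0<..<1}. x < z \<and> z < y" using dense[of x y] by force
qed auto

text \<open>\<open>lt\<close> is an arbitrary relation, so that the same induction yields least
  elements when applied to the converse.\<close>

lemma finite_order_has_greatest:
  assumes "finite L" "L \<noteq> {}" "L \<subseteq> A"
    and tr: "\<And>x y z. x \<in> A \<Longrightarrow> y \<in> A \<Longrightarrow> z \<in> A \<Longrightarrow> lt x y \<Longrightarrow> lt y z \<Longrightarrow> lt x z"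
    and tot: "\<And>x y. x \<in> A \<Longrightarrow> y \<in> A \<Longrightarrow> x \<noteq> y \<Longrightarrow> lt x y \<or> lt y x"
  shows "\<exists>m\<in>L. \<forall>l\<in>L. l = m \<or> lt l m"
  using assms(1-3)
proof (induction L rule: finite_ne_induct)
  case (insert x F)
  then obtain m where m: "m \<in> F" "\<forall>l\<in>F. l = m \<or> lt l m" by auto
  have A: "x \<in> A" "m \<in> A" using insert m by auto
  show ?case
  proof (cases "lt m x")
    case True
    then have "\<forall>l\<in>insert x F. l = x \<or> lt l x"
      using m A tr[of _ m x] insert.prems by (metis insert_iff subsetD)
    then show ?thesis by blast
  next
    case False
    then have "x = m \<or> lt x m" using tot A by blast
    then show ?thesis using m by blast
  qed
qed auto

lemma dense_unbounded_order_separates: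
  assumes B: "dense_unbounded_order B lt"
    and "finite L" "finite U" "L \<subseteq> B" "U \<subseteq> B" and LU: "\<And>l u. l \<in> L \<Longrightarrow> u \<in> U \<Longrightarrow> lt l u"
  shows "\<exists>b\<in>B. (\<forall>l\<in>L. lt l b) \<and> (\<forall>u\<in>U. lt b u)"
proof -
  note D = dense_unbounded_orderD[OF B]
  have mx: "\<exists>m\<in>L. \<forall>l\<in>L. l = m \<or> lt l m" if "L \<noteq> {}"
    using finite_order_has_greatest[OF \<open>finite L\<close> that \<open>L \<subseteq> B\<close>, of lt] D by blast
  have mn: "\<exists>m\<in>U. \<forall>l\<in>U. l = m \<or> lt m l" if "U \<noteq> {}"
    using finite_order_has_greatest[OF \<open>finite U\<close> that \<open>U \<subseteq> B\<close>, of "\<lambda>x y. lt y x"] D by blast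
  consider "L = {}" "U = {}" | "L \<noteq> {}" "U = {}" | "L = {}" "U \<noteq> {}" | "L \<noteq> {}" "U \<noteq> {}" by blast
  then show ?thesis
  proof cases
    case 1 then show ?thesis using D(1) by blast
  next
    case 2
    then obtain m where m: "m \<in> L" "\<forall>l\<in>L. l = m \<or> lt l m" using mx by blast
    obtain b where "b \<in> B" "lt m b" using D(6) m assms(4) by blast
    then have "\<forall>l\<in>L. lt l b" using m assms(4) D(3)[of _ m b] by (metis subsetD)
    then show ?thesis using \<open>b \<in> B\<close> 2 by blast
  next
    case 3
    then obtain m where m: "m \<in> U" "\<forall>l\<in>U. l = m \<or> lt m l" using mn by blast
    obtain b where "b \<in> B" "lt b m" using D(7) m assms(5) by blast
    then have "\<forall>l\<in>U. lt b l" using m assms(5) D(3)[of b m] by (metis subsetD)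
    then show ?thesis using \<open>b \<in> B\<close> 3 by blast
  next
    case 4
    then obtain m m' where m: "m \<in> L" "\<forall>l\<in>L. l = m \<or> lt l m" "m' \<in> U" "\<forall>l\<in>U. l = m' \<or> lt m' l"
      using mx mn by metis
    obtain b where "b \<in> B" "lt m b" "lt b m'" using D(5)[of m m'] m assms(4,5) LU by blast
    then have "\<forall>l\<in>L. lt l b" "\<forall>l\<in>U. lt b l"
      using m assms(4,5) D(3)[of _ m b] D(3)[of b m'] by (metis subsetD)+
    then show ?thesis using \<open>b \<in> B\<close> by blast
  qed
qed

text \<open>A finite partial isomorphism is kept as its graph, so that the back step is the forth
  step for the converse relation.\<close>

definition finite_order_iso ::
    "'a set \<Rightarrow> ('a \<Rightarrow> 'a \<Rightarrow> bool) \<Rightarrow> 'b set \<Rightarrow> ('b \<Rightarrow> 'b \<Rightarrow> bool) \<Rightarrow> ('a \<times> 'b) set \<Rightarrow> bool" where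
  "finite_order_iso A ltA B ltB p \<longleftrightarrow> finite p \<and> p \<subseteq> A \<times> B \<and>
     (\<forall>(a, b)\<in>p. \<forall>(a', b')\<in>p. (a = a' \<longleftrightarrow> b = b') \<and> (ltA a a' \<longleftrightarrow> ltB b b'))"

lemma finite_order_iso_converse:
  "finite_order_iso A ltA B ltB p \<Longrightarrow> finite_order_iso B ltB A ltA (p\<inverse>)"
  unfolding finite_order_iso_def by fastforce

lemma finite_order_iso_forth:
  assumes A: "dense_unbounded_order A ltA" and B: "dense_unbounded_order B ltB"
    and p: "finite_order_iso A ltA B ltB p" and a: "a \<in> A"
  shows "\<exists>p'. finite_order_iso A ltA B ltB p' \<and> p \<subseteq> p' \<and> a \<in> Domain p'"
proof (cases "a \<in> Domain p")
  case False
  note DA = dense_unbounded_orderD[OF A]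
  note DB = dense_unbounded_orderD[OF B]
  have fin: "finite p" and sub: "p \<subseteq> A \<times> B" using p by (auto simp: finite_order_iso_def)
  have iso: "(a1 = a2 \<longleftrightarrow> b1 = b2) \<and> (ltA a1 a2 \<longleftrightarrow> ltB b1 b2)"
    if "(a1, b1) \<in> p" "(a2, b2) \<in> p" for a1 a2 b1 b2
    using p that by (fastforce simp: finite_order_iso_def)
  \<comment> \<open>The partners of the elements below and above \<open>a\<close>; any new value
    strictly between these two finite sets can serve as the partner of \<open>a\<close>.\<close>
  define L where "L = snd ` {z\<in>p. ltA (fst z) a}"
  define U where "U = snd ` {z\<in>p. ltA a (fst z)}"
  have "\<exists>b\<in>B. (\<forall>l\<in>L. ltB l b) \<and> (\<forall>u\<in>U. ltB b u)"
  proof (rule dense_unbounded_order_separates[OF B])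
    show "finite L" "finite U" using fin by (auto simp: L_def U_def)
    show "L \<subseteq> B" "U \<subseteq> B" using sub by (auto simp: L_def U_def)
    fix l u assume "l \<in> L" "u \<in> U"
    then obtain a1 a2 where "(a1, l) \<in> p" "ltA a1 a" "(a2, u) \<in> p" "ltA a a2"
      by (auto simp: L_def U_def)
    then show "ltB l u" using iso[of a1 l a2 u] DA(3)[of a1 a a2] sub a by blast
  qed
  then obtain b where b: "b \<in> B" "\<forall>l\<in>L. ltB l b" "\<forall>u\<in>U. ltB b u" by blast
  have new: "a \<noteq> a' \<and> b \<noteq> b' \<and> (ltA a a' \<longleftrightarrow> ltB b b') \<and> (ltA a' a \<longleftrightarrow> ltB b' b)"
    if "(a', b') \<in> p" for a' b'
  proof -
    have ne: "a \<noteq> a'" using False that by auto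
    have mem: "a' \<in> A" "b' \<in> B" using that sub by auto
    have 1: "ltA a' a \<Longrightarrow> ltB b' b" using b(2) that by (force simp: L_def)
    have 2: "ltA a a' \<Longrightarrow> ltB b b'" using b(3) that by (force simp: U_def)
    have 3: "ltA a a' \<or> ltA a' a" using DA(4) ne mem a by blast
    have 4: "\<not> (ltB b b' \<and> ltB b' b)" using DB(2,3) mem b(1) by blast
    have 5: "\<not> (ltA a a' \<and> ltA a' a)" using DA(2,3) mem a by blast
    show ?thesis using ne 1 2 3 4 5 DB(2) b(1) by blast
  qed
  have irr: "\<not> ltA a a" "\<not> ltB b b" using DA(2) DB(2) a b by auto
  have "finite_order_iso A ltA B ltB (insert (a, b) p)"
    unfolding finite_order_iso_def
  proof (intro conjI)
    show "\<forall>(a1, b1)\<in>insert (a, b) p. \<forall>(a2, b2)\<in>insert (a, b) p.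
        (a1 = a2 \<longleftrightarrow> b1 = b2) \<and> (ltA a1 a2 \<longleftrightarrow> ltB b1 b2)"
    proof (intro ballI, clarify)
      fix a1 b1 a2 b2 assume "(a1, b1) \<in> insert (a, b) p" "(a2, b2) \<in> insert (a, b) p"
      then show "(a1 = a2 \<longleftrightarrow> b1 = b2) \<and> (ltA a1 a2 \<longleftrightarrow> ltB b1 b2)"
        using new[of a1 b1] new[of a2 b2] iso[of a1 b1 a2 b2] irr by auto
    qed
  qed (use fin sub a b in auto)
  then show ?thesis by blast
qed (use p in blast)

text \<open>Back and forth: stage \<open>n\<close> puts the \<open>n\<close>-th element of
  \<open>A\<close> into the domain and the \<open>n\<close>-th element of \<open>B\<close> into the
  range; the union of the chain is the graph of the isomorphism.\<close>

theorem countable_dense_orders_isomorphic: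
  assumes A: "dense_unbounded_order A ltA" "countable A" and B: "dense_unbounded_order B ltB" "countable B"
  obtains f where "bij_betw f A B" "\<And>x y. x \<in> A \<Longrightarrow> y \<in> A \<Longrightarrow> ltA x y \<longleftrightarrow> ltB (f x) (f y)"
proof -
  let ?iso = "finite_order_iso A ltA B ltB"
  have ne: "A \<noteq> {}" "B \<noteq> {}" using A B dense_unbounded_orderD(1) by blast+
  define eA where "eA = from_nat_into A"
  define eB where "eB = from_nat_into B"
  have eA: "range eA = A" and eB: "range eB = B"
    using ne A B by (auto simp: eA_def eB_def)
  have "\<exists>p. \<forall>n. ?iso (p n) \<and> (p n \<subseteq> p (Suc n) \<and> eA n \<in> Domain (p (Suc n)) \<and> eB n \<in> Range (p (Suc n)))"
  proof (rule dependent_nat_choice)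
    show "\<exists>p. ?iso p" by (rule exI[of _ "{}"]) (simp add: finite_order_iso_def)
    fix p n assume p: "?iso p"
    obtain p1 where p1: "?iso p1" "p \<subseteq> p1" "eA n \<in> Domain p1"
      using finite_order_iso_forth[OF A(1) B(1) p, of "eA n"] eA by auto
    obtain p2 where p2: "finite_order_iso B ltB A ltA p2" "p1\<inverse> \<subseteq> p2" "eB n \<in> Domain p2"
      using finite_order_iso_forth[OF B(1) A(1) finite_order_iso_converse[OF p1(1)], of "eB n"] eB by auto
    show "\<exists>q. ?iso q \<and> p \<subseteq> q \<and> eA n \<in> Domain q \<and> eB n \<in> Range q"
      using finite_order_iso_converse[OF p2(1)] p1 p2 by (intro exI[of _ "p2\<inverse>"]) auto
  qed
  then obtain p where p: "\<And>n. ?iso (p n)" "\<And>n. p n \<subseteq> p (Suc n)"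
    "\<And>n. eA n \<in> Domain (p (Suc n))" "\<And>n. eB n \<in> Range (p (Suc n))" by blast
  have mono: "p m \<subseteq> p n" if "m \<le> n" for m n using lift_Suc_mono_le[of p] p(2) that by blast
  define F where "F = (\<Union>n. p n)"
  have F: "(a = a' \<longleftrightarrow> b = b') \<and> (ltA a a' \<longleftrightarrow> ltB b b')" if ab: "(a, b) \<in> F" "(a', b') \<in> F" for a b a' b'
  proof -
    obtain m n where "(a, b) \<in> p m" "(a', b') \<in> p n" using ab unfolding F_def by blast
    then have "(a, b) \<in> p (max m n)" "(a', b') \<in> p (max m n)"
      using mono[of m "max m n"] mono[of n "max m n"] by auto
    then show ?thesis using p(1)[of "max m n"] by (fastforce simp: finite_order_iso_def)
  qed
  have FAB: "F \<subseteq> A \<times> B" using p(1) by (auto simp: F_def finite_order_iso_def)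
  have dom: "\<exists>b. (a, b) \<in> F" if aA: "a \<in> A" for a
  proof -
    obtain n where "a = eA n" using eA aA by blast
    then show ?thesis using p(3)[of n] by (auto simp: F_def)
  qed
  have ran: "\<exists>a. (a, b) \<in> F" if bB: "b \<in> B" for b
  proof -
    obtain n where "b = eB n" using eB bB by blast
    then show ?thesis using p(4)[of n] by (auto simp: F_def)
  qed
  define f where "f a = (SOME b. (a, b) \<in> F)" for a
  have f: "(a, f a) \<in> F" if "a \<in> A" for a using dom[OF that] unfolding f_def by (rule someI_ex)
  show thesis
  proof
    show "bij_betw f A B"
    proof (rule bij_betw_imageI)
      show "inj_on f A" using F f by (meson inj_onI)
      show "f ` A = B"
      proof
        show "f ` A \<subseteq> B" using f FAB by blast
        show "B \<subseteq> f ` A" 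
        proof
          fix b assume "b \<in> B"
          then obtain a where "(a, b) \<in> F" using ran by blast
          then show "b \<in> f ` A" using F[of a b a "f a"] f FAB by blast
        qed
      qed
    qed
    show "ltA x y \<longleftrightarrow> ltB (f x) (f y)" if "x \<in> A" "y \<in> A" for x y using F f that by blast
  qed
qed

subsection \<open>Automorphisms\<close>

lemma digraph_aut_comp:
  "digraph_aut V R g \<Longrightarrow> digraph_aut V R h \<Longrightarrow> digraph_aut V R (g \<circ> h)"
  unfolding digraph_aut_def digraph_iso_def
  by (auto intro: bij_betw_trans) (metis bij_betwE)+

lemma digraph_aut_inv:
  assumes "digraph_aut V R g"
  shows "digraph_aut V R (inv_into V g)"
proof -
  have g: "bij_betw g V V" and R: "\<And>x y. x \<in> V \<Longrightarrow> y \<in> V \<Longrightarrow> (x, y) \<in> R \<longleftrightarrow> (g x, g y) \<in> R"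
    using assms by (auto simp: digraph_aut_def digraph_iso_def)
  have mem: "inv_into V g x \<in> V" if "x \<in> V" for x
    using bij_betw_inv_into[OF g] that by (auto dest: bij_betwE)
  show ?thesis
    unfolding digraph_aut_def digraph_iso_def
  proof (intro conjI ballI)
    show "bij_betw (inv_into V g) V V" by (rule bij_betw_inv_into[OF g])
    fix x y assume "x \<in> V" "y \<in> V"
    then show "(x, y) \<in> R \<longleftrightarrow> (inv_into V g x, inv_into V g y) \<in> R"
      using R[OF mem mem] bij_betw_inv_into_right[OF g] by metis
  qed
qed

text \<open>Only the image of \<open>U\<close> is controlled: \<open>g\<close> may differ from
  \<open>f\<close> on \<open>U\<close>. The pointwise versions below recover the values of
  \<open>g\<close> from rigidity.\<close>

lemma set_homogeneous_extend:
  assumes "set_homogeneous V R" "finite U" "U \<subseteq> V" "inj_on f U" "f ` U \<subseteq> V"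
    and "\<And>x y. x \<in> U \<Longrightarrow> y \<in> U \<Longrightarrow> (x, y) \<in> R \<longleftrightarrow> (f x, f y) \<in> R"
  shows "\<exists>g. digraph_aut V R g \<and> g ` U = f ` U"
proof -
  have "digraph_iso U (Restr R U) (f ` U) (Restr R (f ` U)) f"
    using assms(4,6) by (auto simp: digraph_iso_def inj_on_imp_bij_betw)
  then show ?thesis using assms unfolding set_homogeneous_def isomorphic_digraphs_def by blast
qed

lemma set_homogeneous_converse:
  assumes "set_homogeneous V R"
  shows "set_homogeneous V (R\<inverse>)"
proof -
  have "isomorphic_digraphs U (Restr (R\<inverse>) U) W (Restr (R\<inverse>) W) \<longleftrightarrow>
      isomorphic_digraphs U (Restr R U) W (Restr R W)" for U W :: "'a set"
    unfolding isomorphic_digraphs_def digraph_iso_def by auto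
  moreover have "digraph_aut V (R\<inverse>) g \<longleftrightarrow> digraph_aut V R g" for g
    unfolding digraph_aut_def digraph_iso_def by auto
  ultimately show ?thesis
    using assms unfolding set_homogeneous_def by simp
qed

subsection \<open>Orienting the unrelated pairs\<close>

text \<open>\<open>B\<close> is one of the two orbits of the automorphism group on ordered unrelated pairs.\<close>

locale oriented_digraph =
  fixes V :: "'a set" and R B :: "'a rel"
  assumes digraph: "a_digraph V R"
    and homogeneous: "set_homogeneous V R"
    and blue_subset: "B \<subseteq> V \<times> V"
    and blue_unrelated: "(x, y) \<in> B \<Longrightarrow> (x, y) \<notin> R \<and> (y, x) \<notin> R \<and> (y, x) \<notin> B"
    and unrelated_blue: "x \<in> V \<Longrightarrow> y \<in> V \<Longrightarrow> x \<noteq> y \<Longrightarrow>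
      (x, y) \<in> R \<or> (y, x) \<in> R \<or> (x, y) \<in> B \<or> (y, x) \<in> B"
    and aut_blue: "digraph_aut V R g \<Longrightarrow> (x, y) \<in> B \<Longrightarrow> (g x, g y) \<in> B"
    and red_nonempty: "R \<noteq> {}"
    and blue_nonempty: "B \<noteq> {}"
begin

abbreviation red (infix "\<leadsto>" 50) where "x \<leadsto> y \<equiv> (x, y) \<in> R"
abbreviation blue (infix "\<Rrightarrow>" 50) where "x \<Rrightarrow> y \<equiv> (x, y) \<in> B"
abbreviation unrelated (infix "\<parallel>" 50) where "x \<parallel> y \<equiv> x \<Rrightarrow> y \<or> y \<Rrightarrow> x"
abbreviation "aut \<equiv> digraph_aut V R"

lemma red_mem: "x \<leadsto> y \<Longrightarrow> x \<in> V \<and> y \<in> V"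
  using digraph by (auto simp: a_digraph_def)

lemma red_irrefl: "\<not> x \<leadsto> x"
  using digraph by (auto simp: a_digraph_def irrefl_def)

lemma red_asym: "x \<leadsto> y \<Longrightarrow> \<not> y \<leadsto> x"
  using digraph red_irrefl by (auto simp: a_digraph_def dest: antisymD)

lemma blue_mem: "x \<Rrightarrow> y \<Longrightarrow> x \<in> V \<and> y \<in> V"
  using blue_subset by auto

lemma blue_irrefl: "\<not> x \<Rrightarrow> x"
  using blue_unrelated by blast

lemma blue_asym: "x \<Rrightarrow> y \<Longrightarrow> \<not> y \<Rrightarrow> x"
  using blue_unrelated by blast

lemma red_not_blue: "x \<leadsto> y \<Longrightarrow> \<not> x \<Rrightarrow> y \<and> \<not> y \<Rrightarrow> x"
  using blue_unrelated by blast

lemma red_neq: "x \<leadsto> y \<Longrightarrow> x \<noteq> y"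
  using red_irrefl by blast

lemma blue_neq: "x \<Rrightarrow> y \<Longrightarrow> x \<noteq> y"
  using blue_irrefl by blast

lemma redD: "x \<leadsto> y \<Longrightarrow> x \<in> V \<and> y \<in> V \<and> x \<noteq> y \<and> y \<noteq> x \<and> \<not> y \<leadsto> x \<and> \<not> x \<Rrightarrow> y \<and> \<not> y \<Rrightarrow> x"
  using red_mem red_neq red_asym red_not_blue by blast

lemma unrelatedD: "x \<parallel> y \<Longrightarrow> x \<in> V \<and> y \<in> V \<and> x \<noteq> y \<and> y \<noteq> x \<and> \<not> x \<leadsto> y \<and> \<not> y \<leadsto> x"
  using blue_mem blue_neq blue_unrelated by blast

lemmas rel_mem = red_mem blue_mem

lemma aut_red: "aut g \<Longrightarrow> x \<leadsto> y \<Longrightarrow> g x \<leadsto> g y"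
  using red_mem unfolding digraph_aut_def digraph_iso_def by blast

section \<open>Small configurations that automorphisms match point by point\<close>

lemma hom_vertex:
  assumes "x \<in> V" "x' \<in> V"
  shows "\<exists>g. aut g \<and> g x = x'"
  using set_homogeneous_extend[OF homogeneous, of "{x}" "\<lambda>_. x'"] assms red_irrefl by auto

lemma hom_red:
  assumes "a \<leadsto> b" "a' \<leadsto> b'"
  shows "\<exists>g. aut g \<and> g a = a' \<and> g b = b'"
proof -
  have "\<exists>g. aut g \<and> g ` {a, b} = (id(a := a', b := b')) ` {a, b}"
    using assms redD[OF assms(1)] redD[OF assms(2)] red_irrefl
    by (intro set_homogeneous_extend[OF homogeneous]) (auto simp: inj_on_def)
  then obtain g where g: "aut g" "g ` {a, b} = {a', b'}" using redD[OF assms(1)] by auto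
  have "g a \<leadsto> g b" using g assms aut_red by blast
  moreover have "g a = a' \<and> g b = b' \<or> g a = b' \<and> g b = a'" using g(2) by (auto simp: doubleton_eq_iff)
  ultimately have "g a = a' \<and> g b = b'" using redD[OF assms(2)] by auto
  then show ?thesis using g by blast
qed

text \<open>As a digraph, an unrelated pair can be swapped; the invariance of \<open>B\<close> is
  what rules the swap out.\<close>

lemma hom_blue:
  assumes "a \<Rrightarrow> b" "a' \<Rrightarrow> b'"
  shows "\<exists>g. aut g \<and> g a = a' \<and> g b = b'"
proof -
  have "\<exists>g. aut g \<and> g ` {a, b} = (id(a := a', b := b')) ` {a, b}"
    using unrelatedD[of a b] unrelatedD[of a' b'] assms red_irrefl
    by (intro set_homogeneous_extend[OF homogeneous]) (auto simp: inj_on_def)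
  then obtain g where g: "aut g" "g ` {a, b} = {a', b'}" using unrelatedD[of a b] assms by auto
  have "g a \<Rrightarrow> g b" using g assms aut_blue by blast
  moreover have "g a = a' \<and> g b = b' \<or> g a = b' \<and> g b = a'" using g(2) by (auto simp: doubleton_eq_iff)
  ultimately have "g a = a' \<and> g b = b'" using blue_asym[OF assms(2)] by auto
  then show ?thesis using g by blast
qed

lemma hom_triple:
  assumes "distinct [a, b, c]" "distinct [a', b', c']" "{a, b, c, a', b', c'} \<subseteq> V"
    and "a \<leadsto> b \<longleftrightarrow> a' \<leadsto> b'" "b \<leadsto> a \<longleftrightarrow> b' \<leadsto> a'" "b \<leadsto> c \<longleftrightarrow> b' \<leadsto> c'" "c \<leadsto> b \<longleftrightarrow> c' \<leadsto> b'"
    and "a \<leadsto> c \<longleftrightarrow> a' \<leadsto> c'" "c \<leadsto> a \<longleftrightarrow> c' \<leadsto> a'"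
  shows "\<exists>g. aut g \<and> g ` {a, b, c} = {a', b', c'}"
proof -
  have "\<exists>g. aut g \<and> g ` {a, b, c} = (id(a := a', b := b', c := c')) ` {a, b, c}"
    using assms red_irrefl
    by (intro set_homogeneous_extend[OF homogeneous]) (auto simp: inj_on_def)
  then show ?thesis using assms(1) by auto
qed

lemma hom_quadruple:
  assumes "distinct [a, b, c, d]" "distinct [a', b', c', d']" "{a, b, c, d, a', b', c', d'} \<subseteq> V"
    and "a \<leadsto> b \<longleftrightarrow> a' \<leadsto> b'" "b \<leadsto> a \<longleftrightarrow> b' \<leadsto> a'" "b \<leadsto> c \<longleftrightarrow> b' \<leadsto> c'" "c \<leadsto> b \<longleftrightarrow> c' \<leadsto> b'"
    and "a \<leadsto> c \<longleftrightarrow> a' \<leadsto> c'" "c \<leadsto> a \<longleftrightarrow> c' \<leadsto> a'" "a \<leadsto> d \<longleftrightarrow> a' \<leadsto> d'" "d \<leadsto> a \<longleftrightarrow> d' \<leadsto> a'"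
    and "b \<leadsto> d \<longleftrightarrow> b' \<leadsto> d'" "d \<leadsto> b \<longleftrightarrow> d' \<leadsto> b'" "c \<leadsto> d \<longleftrightarrow> c' \<leadsto> d'" "d \<leadsto> c \<longleftrightarrow> d' \<leadsto> c'"
  shows "\<exists>g. aut g \<and> g ` {a, b, c, d} = {a', b', c', d'}"
proof -
  define f where "f = id(a := a', b := b', c := c', d := d')"
  have f: "f a = a'" "f b = b'" "f c = c'" "f d = d'" using assms(1) by (auto simp: f_def)
  have "\<exists>g. aut g \<and> g ` {a, b, c, d} = f ` {a, b, c, d}"
  proof (rule set_homogeneous_extend[OF homogeneous])
    show "inj_on f {a, b, c, d}" using assms(1,2) by (simp add: f)
    fix x y assume "x \<in> {a, b, c, d}" "y \<in> {a, b, c, d}"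
    then show "x \<leadsto> y \<longleftrightarrow> f x \<leadsto> f y"
      by (elim insertE emptyE) (simp_all add: f assms(4-) red_irrefl)
  qed (use assms(3) in \<open>auto simp: f\<close>)
  then show ?thesis by (simp add: f)
qed

text \<open>The vertex \<open>c\<close> is recognised as the one off the arc, so the orientation of
  the unrelated pairs need not be assumed. Hence \<open>B\<close> orients all such triples in the
  same way.\<close>

lemma hom_arc_point:
  assumes "a \<leadsto> b" "a \<parallel> c" "b \<parallel> c" "a' \<leadsto> b'" "a' \<parallel> c'" "b' \<parallel> c'"
  shows "\<exists>g. aut g \<and> g a = a' \<and> g b = b' \<and> g c = c'"
proof -
  have "\<exists>g. aut g \<and> g ` {a, b, c} = {a', b', c'}"
    by (rule hom_triple) (use assms redD[OF assms(1)] redD[OF assms(4)] unrelatedD[OF assms(2)] unrelatedD[OF assms(3)] unrelatedD[OF assms(5)] unrelatedD[OF assms(6)] in auto)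
  then obtain g where g: "aut g" "g ` {a, b, c} = {a', b', c'}" by blast
  have 1: "g a \<leadsto> g b" "g a \<parallel> g c" "g b \<parallel> g c" using g assms aut_red aut_blue by blast+
  have mem: "g a \<in> {a', b', c'}" "g b \<in> {a', b', c'}" "g c \<in> {a', b', c'}" using g(2) by blast+
  have ne: "\<not> a' \<leadsto> c'" "\<not> c' \<leadsto> a'" "\<not> b' \<leadsto> c'" "\<not> c' \<leadsto> b'" "\<not> b' \<leadsto> a'"
    using assms redD unrelatedD by blast+
  have "g a = a' \<and> g b = b'" using mem ne 1(1) red_irrefl by auto
  then have "g c = c'" using mem 1 blue_irrefl by auto
  then show ?thesis using g \<open>g a = a' \<and> g b = b'\<close> by blast
qed

text \<open>Here too the orientation of the unrelated ends is left open, so all red paths with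
  unrelated ends agree in it.\<close>

lemma hom_path:
  assumes "a \<leadsto> b" "b \<leadsto> c" "a \<parallel> c" "a' \<leadsto> b'" "b' \<leadsto> c'" "a' \<parallel> c'"
  shows "\<exists>g. aut g \<and> g a = a' \<and> g b = b' \<and> g c = c'"
proof -
  have "\<exists>g. aut g \<and> g ` {a, b, c} = {a', b', c'}"
    by (rule hom_triple) (use assms redD[OF assms(1)] redD[OF assms(2)] redD[OF assms(4)] redD[OF assms(5)] unrelatedD[OF assms(3)] unrelatedD[OF assms(6)] in auto)
  then obtain g where g: "aut g" "g ` {a, b, c} = {a', b', c'}" by blast
  have 1: "g a \<leadsto> g b" "g b \<leadsto> g c" using g assms aut_red by blast+
  have mem: "g a \<in> {a', b', c'}" "g b \<in> {a', b', c'}" "g c \<in> {a', b', c'}" using g(2) by blast+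
  have ne: "\<not> a' \<leadsto> c'" "\<not> c' \<leadsto> a'" "\<not> c' \<leadsto> b'" "\<not> b' \<leadsto> a'"
    using assms redD unrelatedD by blast+
  have "g a = a' \<and> g b = b' \<and> g c = c'" using mem ne 1 red_irrefl by auto
  then show ?thesis using g by blast
qed

lemma hom_transitive:
  assumes "a \<leadsto> b" "b \<leadsto> c" "a \<leadsto> c" "a' \<leadsto> b'" "b' \<leadsto> c'" "a' \<leadsto> c'"
  shows "\<exists>g. aut g \<and> g a = a' \<and> g b = b' \<and> g c = c'"
proof -
  have "\<exists>g. aut g \<and> g ` {a, b, c} = {a', b', c'}"
    by (rule hom_triple) (use assms redD[OF assms(1)] redD[OF assms(2)] redD[OF assms(3)] redD[OF assms(4)] redD[OF assms(5)] redD[OF assms(6)] in auto)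
  then obtain g where g: "aut g" "g ` {a, b, c} = {a', b', c'}" by blast
  have 1: "g a \<leadsto> g b" "g b \<leadsto> g c" "g a \<leadsto> g c" using g assms aut_red by blast+
  have mem: "g a \<in> {a', b', c'}" "g b \<in> {a', b', c'}" "g c \<in> {a', b', c'}" using g(2) by blast+
  have ne: "\<not> c' \<leadsto> a'" "\<not> c' \<leadsto> b'" "\<not> b' \<leadsto> a'"
    using assms redD unrelatedD by blast+
  have "g a = a' \<and> g b = b' \<and> g c = c'" using mem ne 1 red_irrefl by auto
  then show ?thesis using g by blast
qed

text \<open>The arcs are acyclic and contain the path \<open>l\<close>, \<open>c\<close>,
  \<open>a\<close>, \<open>h\<close>, so there is only one topological order and the digraph is
  rigid.\<close>

lemma hom_diamond:
  assumes "l \<leadsto> c" "l \<leadsto> a" "c \<leadsto> a" "c \<leadsto> h" "a \<leadsto> h" "l \<parallel> h"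
    and "l' \<leadsto> c'" "l' \<leadsto> a'" "c' \<leadsto> a'" "c' \<leadsto> h'" "a' \<leadsto> h'" "l' \<parallel> h'"
  shows "\<exists>g. aut g \<and> g l = l' \<and> g c = c' \<and> g a = a' \<and> g h = h'"
proof -
  have "\<exists>g. aut g \<and> g ` {l, c, a, h} = {l', c', a', h'}"
    by (rule hom_quadruple) (use assms redD[OF assms(1)] redD[OF assms(2)] redD[OF assms(3)] redD[OF assms(4)] redD[OF assms(5)] redD[OF assms(7)] redD[OF assms(8)] redD[OF assms(9)] redD[OF assms(10)] redD[OF assms(11)] unrelatedD[OF assms(6)] unrelatedD[OF assms(12)] in auto)
  then obtain g where g: "aut g" "g ` {l, c, a, h} = {l', c', a', h'}" by blast
  have 1: "g l \<leadsto> g c" "g c \<leadsto> g a" "g a \<leadsto> g h" "g l \<leadsto> g a" "g c \<leadsto> g h"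
    using g assms aut_red by blast+
  have mem: "g l \<in> {l', c', a', h'}" "g c \<in> {l', c', a', h'}" "g a \<in> {l', c', a', h'}"
    "g h \<in> {l', c', a', h'}" using g(2) by blast+
  have ne: "\<not> h' \<leadsto> a'" "\<not> h' \<leadsto> c'" "\<not> h' \<leadsto> l'" "\<not> l' \<leadsto> h'" "\<not> a' \<leadsto> c'" "\<not> a' \<leadsto> l'" "\<not> c' \<leadsto> l'"
    using assms redD unrelatedD by blast+
  have "g h = h'" using mem ne 1 red_irrefl by auto
  then have "g a = a'" using mem ne 1 red_irrefl by auto
  then have "g c = c'" using mem ne 1 red_irrefl by auto
  then have "g l = l'" using mem ne 1 red_irrefl by auto
  then show ?thesis using g \<open>g h = h'\<close> \<open>g a = a'\<close> \<open>g c = c'\<close> by blast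
qed

text \<open>Any two triples of pairwise unrelated vertices are isomorphic as digraphs, so
  \<open>B\<close> cannot be cyclic on one and transitive on another.\<close>

lemma independent_triples_alike:
  assumes "x \<Rrightarrow> y" "y \<Rrightarrow> z" "z \<Rrightarrow> x" "u \<Rrightarrow> v" "v \<Rrightarrow> w"
  shows "\<not> u \<Rrightarrow> w"
proof
  assume uw: "u \<Rrightarrow> w"
  have "\<exists>g. aut g \<and> g ` {u, v, w} = {x, y, z}"
    by (rule hom_triple) (use assms uw unrelatedD[of x y] unrelatedD[of y z] unrelatedD[of z x]
      unrelatedD[of u v] unrelatedD[of v w] unrelatedD[of u w] in auto)
  then obtain g where g: "aut g" "g ` {u, v, w} = {x, y, z}" by blast
  have 1: "g u \<Rrightarrow> g v" "g v \<Rrightarrow> g w" "g u \<Rrightarrow> g w" using g assms uw aut_blue by blast+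
  have mem: "g u \<in> {x, y, z}" "g v \<in> {x, y, z}" "g w \<in> {x, y, z}" using g(2) by blast+
  have ne: "\<not> y \<Rrightarrow> x" "\<not> z \<Rrightarrow> y" "\<not> x \<Rrightarrow> z" using assms blue_asym by blast+
  show False using mem ne 1 blue_irrefl by auto
qed

lemma vertex_degrees:
  assumes "x \<in> V"
  shows "\<exists>y. x \<leadsto> y" "\<exists>y. y \<leadsto> x" "\<exists>y. x \<Rrightarrow> y" "\<exists>y. y \<Rrightarrow> x"
proof -
  obtain a b c d where ab: "a \<leadsto> b" and cd: "c \<Rrightarrow> d" using red_nonempty blue_nonempty by auto
  show "\<exists>y. x \<leadsto> y" "\<exists>y. y \<leadsto> x"
    using ab hom_vertex[of a x] hom_vertex[of b x] red_mem[OF ab] aut_red assms by metis+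
  show "\<exists>y. x \<Rrightarrow> y" "\<exists>y. y \<Rrightarrow> x"
    using cd hom_vertex[of c x] hom_vertex[of d x] blue_mem[OF cd] aut_blue assms by metis+
qed

text \<open>The two orbits on unrelated pairs are on a par. This dualises results about
  \<open>B\<close> and lets the final case split choose the orientation.\<close>

lemma reverse_blue: "oriented_digraph V R (B\<inverse>)"
proof
  show "(x, y) \<in> R \<or> (y, x) \<in> R \<or> (x, y) \<in> B\<inverse> \<or> (y, x) \<in> B\<inverse>" if "x \<in> V" "y \<in> V" "x \<noteq> y" for x y
    using unrelated_blue[OF that] by auto
qed (use digraph homogeneous blue_subset blue_unrelated aut_blue red_nonempty blue_nonempty in auto)

lemma reverse_red: "oriented_digraph V (R\<inverse>) B"
proof
  show "a_digraph V (R\<inverse>)" using digraph by (auto simp: a_digraph_def irrefl_def)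
  show "set_homogeneous V (R\<inverse>)" by (rule set_homogeneous_converse[OF homogeneous])
  fix g x y assume "digraph_aut V (R\<inverse>) g" "(x, y) \<in> B"
  moreover from this(1) have "aut g" unfolding digraph_aut_def digraph_iso_def by auto
  ultimately show "(g x, g y) \<in> B" using aut_blue by blast
next
  show "(x, y) \<in> R\<inverse> \<or> (y, x) \<in> R\<inverse> \<or> (x, y) \<in> B \<or> (y, x) \<in> B" if "x \<in> V" "y \<in> V" "x \<noteq> y" for x y
    using unrelated_blue[OF that] by auto
qed (use blue_subset blue_unrelated red_nonempty blue_nonempty in auto)

end

section \<open>Existence of the invariant orientation\<close>

text \<open>An isomorphism \<open>f\<close> between pairs that does not extend is still realised up
  to a swap, so no automorphism exchanges the two points \<open>x\<close>, \<open>y\<close>. The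
  orbit of \<open>(x, y)\<close> then orients every unrelated pair, because all of these are
  isomorphic.\<close>

lemma oriented_digraph_exists:
  assumes V: "a_digraph V R" and hom: "set_homogeneous V R" and "\<not> k_homogeneous 2 V R"
  shows "\<exists>B. oriented_digraph V R B"
proof -
  obtain U W f where UW: "U \<subseteq> V" "W \<subseteq> V" "card U = 2" "card W = 2"
    and f: "digraph_iso U (Restr R U) W (Restr R W) f"
    and nof: "\<And>g. digraph_aut V R g \<Longrightarrow> \<exists>x\<in>U. g x \<noteq> f x"
    using assms(3) unfolding k_homogeneous_def by meson
  obtain x y where U: "U = {x, y}" "x \<noteq> y" using UW(3) by (auto simp: card_2_iff)
  have fb: "bij_betw f U W" and fR: "\<And>u v. u \<in> U \<Longrightarrow> v \<in> U \<Longrightarrow> (u, v) \<in> R \<longleftrightarrow> (f u, f v) \<in> R"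
    using f by (auto simp: digraph_iso_def bij_betw_def)
  have W: "W = {f x, f y}" "f x \<noteq> f y"
    using fb U by (auto simp: bij_betw_def inj_on_def)
  have memV: "x \<in> V" "y \<in> V" "f x \<in> V" "f y \<in> V" using UW U W by auto
  have irr: "(u, u) \<notin> R" for u using V by (auto simp: a_digraph_def irrefl_def)
  have asym: "(u, v) \<in> R \<Longrightarrow> (v, u) \<notin> R" for u v
    using V irr by (auto simp: a_digraph_def dest: antisymD)
  have autR: "(u, v) \<in> R \<Longrightarrow> (g u, g v) \<in> R" if "digraph_aut V R g" for g u v
    using that V unfolding digraph_aut_def digraph_iso_def a_digraph_def by blast
  have autR': "(g u, g v) \<in> R \<Longrightarrow> (u, v) \<in> R" if "digraph_aut V R g" "u \<in> V" "v \<in> V" for g u v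
    using that unfolding digraph_aut_def digraph_iso_def by blast
  have autV: "g u \<in> V" if "digraph_aut V R g" "u \<in> V" for g u
    using that unfolding digraph_aut_def digraph_iso_def by (auto dest: bij_betwE)
  have "\<exists>g. digraph_aut V R g \<and> g ` {x, y} = f ` {x, y}"
    by (rule set_homogeneous_extend[OF hom]) (use memV W(2) fR U(1) in \<open>auto simp: inj_on_def\<close>)
  then obtain g0 where g0: "digraph_aut V R g0" "{g0 x, g0 y} = {f x, f y}" by auto
  \<comment> \<open>\<open>g0\<close> has the same image as \<open>f\<close> but does not extend it,
    so it takes the two values in the other order.\<close>
  have swap0: "g0 x = f y" "g0 y = f x"
    using nof[OF g0(1)] g0(2) U by (auto simp: doubleton_eq_iff)
  \<comment> \<open>An arc between \<open>x\<close> and \<open>y\<close> would be sent to opposite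
    arcs by \<open>f\<close> and by \<open>g0\<close>.\<close>
  have un: "(x, y) \<notin> R" "(y, x) \<notin> R"
    using autR[OF g0(1), of x y] autR[OF g0(1), of y x] swap0 fR[of x y] fR[of y x] U asym by auto
  have no_swap: False if k: "digraph_aut V R k" "k x = y" "k y = x" for k
  proof -
    have "digraph_aut V R (g0 \<circ> k)" using digraph_aut_comp g0(1) k(1) by blast
    from nof[OF this] show False using k swap0 U by auto
  qed
  define B where "B = {(g x, g y) |g. digraph_aut V R g}"
  show ?thesis
  proof (intro exI[of _ B] oriented_digraph.intro)
    show "B \<subseteq> V \<times> V" using autV memV by (auto simp: B_def)
    show "(u, v) \<notin> R \<and> (v, u) \<notin> R \<and> (v, u) \<notin> B" if "(u, v) \<in> B" for u v
    proof -
      obtain g where g: "digraph_aut V R g" "u = g x" "v = g y" using \<open>(u, v) \<in> B\<close> by (auto simp: B_def)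
      have "(v, u) \<notin> B"
      proof
        assume "(v, u) \<in> B"
        then obtain h where h: "digraph_aut V R h" "v = h x" "u = h y" by (auto simp: B_def)
        have bij: "inj_on h V" using h(1) unfolding digraph_aut_def digraph_iso_def bij_betw_def by blast
        \<comment> \<open>If the orbit contained both directions, \<open>g\<close> followed by the
          inverse of \<open>h\<close> would exchange \<open>x\<close> and \<open>y\<close>.\<close>
        have "digraph_aut V R (inv_into V h \<circ> g)" using digraph_aut_comp digraph_aut_inv g(1) h(1) by blast
        moreover have "(inv_into V h \<circ> g) x = y" "(inv_into V h \<circ> g) y = x"
          using g h bij memV by (metis comp_apply inv_into_f_f)+
        ultimately show False using no_swap by blast
      qed
      then show ?thesis using g un autR' memV by blast
    qed
    show "(u, v) \<in> R \<or> (v, u) \<in> R \<or> (u, v) \<in> B \<or> (v, u) \<in> B" if uv: "u \<in> V" "v \<in> V" "u \<noteq> v" for u v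
    proof (cases "(u, v) \<in> R \<or> (v, u) \<in> R")
      case False
      have "\<exists>g. digraph_aut V R g \<and> g ` {x, y} = (id(x := u, y := v)) ` {x, y}"
        using False uv U(2) un irr memV
        by (intro set_homogeneous_extend[OF hom]) (auto simp: inj_on_def)
      then obtain g where g: "digraph_aut V R g" "g ` {x, y} = {u, v}" using U by auto
      then have "(g x = u \<and> g y = v) \<or> (g x = v \<and> g y = u)" using uv by auto
      then show ?thesis using g(1) by (auto simp: B_def)
    qed auto
    show "(g u, g v) \<in> B" if "digraph_aut V R g" "(u, v) \<in> B" for g u v
      using that digraph_aut_comp[of V R g] by (auto simp: B_def) (metis comp_apply)
    show "R \<noteq> {}"
    proof
      \<comment> \<open>Without arcs the transposition of \<open>x\<close> and \<open>y\<close> is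
        an automorphism.\<close>
      assume "R = {}"
      then have "digraph_aut V R (id(x := y, y := x))"
        using memV by (auto simp: digraph_aut_def digraph_iso_def bij_betw_def inj_on_def)
      then show False using no_swap[of "id(x := y, y := x)"] U by simp
    qed
    show "B \<noteq> {}" using g0 by (auto simp: B_def)
  qed (fact V hom)+
qed

context oriented_digraph
begin

lemma red_or_unrelated:
  "x \<in> V \<Longrightarrow> y \<in> V \<Longrightarrow> x \<noteq> y \<Longrightarrow> \<not> x \<parallel> y \<Longrightarrow> x \<leadsto> y \<or> y \<leadsto> x"
  using unrelated_blue by blast

subsection \<open>An arc cannot have a common blue successor\<close>

text \<open>Otherwise \<open>\<Rrightarrow>\<close> is a partial order in which the elements above a given one form a chain,
  and comparability is unrelatedness. Any transitive red triangle then determines which of its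
  vertices branches off first, and this is incompatible with the ways in which an arc can sit
  under a vertex.\<close>

lemma no_common_successor_aux:
  assumes abc: "a \<leadsto> b" "a \<Rrightarrow> c" "b \<Rrightarrow> c"
    and noP2: "\<And>x y z. x \<leadsto> y \<Longrightarrow> y \<leadsto> z \<Longrightarrow> \<not> z \<Rrightarrow> x"
  shows False
proof -
  \<comment> \<open>One common blue successor of an arc forces, by \<open>hom_arc_point\<close>,
    every vertex unrelated to both ends of an arc to be one.\<close>
  have A4: "x \<Rrightarrow> z \<and> y \<Rrightarrow> z" if "x \<leadsto> y" "x \<parallel> z" "y \<parallel> z" for x y z
    using hom_arc_point[of a b c x y z] that abc aut_blue by metis
  have ext1: "\<exists>z. z \<leadsto> x \<and> z \<Rrightarrow> y" if "x \<Rrightarrow> y" for x y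
    using hom_blue[OF abc(3) that] aut_blue aut_red abc by metis
  have ext2: "\<exists>z. x \<leadsto> z \<and> z \<Rrightarrow> y" if "x \<Rrightarrow> y" for x y
    using hom_blue[OF abc(2) that] aut_blue aut_red abc by metis
  \<comment> \<open>If \<open>y\<close> and \<open>u\<close> were joined by an arc, \<open>x\<close>
    would be unrelated to both ends, and \<open>A4\<close> would turn the blue pair
    \<open>x\<close>, \<open>u\<close> around.\<close>
  have up: "y \<parallel> u" if "x \<Rrightarrow> u" "y \<parallel> x" "y \<noteq> u" for x y u
  proof (rule ccontr)
    assume "\<not> y \<parallel> u"
    then have "y \<leadsto> u \<or> u \<leadsto> y" using red_or_unrelated[of y u] that rel_mem by blast
    then have "u \<Rrightarrow> x" using A4[of y u x] A4[of u y x] that by blast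
    then show False using that blue_asym by blast
  qed
  have noEc: "\<not> z \<Rrightarrow> x" if xyz: "x \<Rrightarrow> y" "y \<Rrightarrow> z" for x y z
  proof
    assume zx: "z \<Rrightarrow> x"
    obtain t where t: "x \<leadsto> t" "t \<Rrightarrow> y" using ext2[OF xyz(1)] by blast
    have "t \<parallel> z" using up[OF xyz(2), of t] t xyz blue_asym by blast
    then have "t \<parallel> x" using up[OF zx, of t] t redD by blast
    then show False using t redD by blast
  qed
  have trans: "x \<Rrightarrow> z" if "x \<Rrightarrow> y" "y \<Rrightarrow> z" for x y z
    using up[OF that(2), of x] noEc[OF that] that blue_asym by blast
  have down: "y \<leadsto> x \<or> x \<leadsto> y" if "x \<Rrightarrow> u" "y \<leadsto> u \<or> u \<leadsto> y" for x y u
  proof -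
    have "x \<noteq> y" using that redD unrelatedD by blast
    moreover have "\<not> y \<parallel> x" using up[OF that(1), of y] that redD by blast
    ultimately show ?thesis using red_or_unrelated[of x y] that rel_mem by blast
  qed
  have chain: "y \<parallel> z" if "x \<Rrightarrow> y" "x \<Rrightarrow> z" "y \<noteq> z" for x y z
    using up[of x y z] up[of x z y] that by blast
  \<comment> \<open>As upper elements form chains, the pairs \<open>p\<close>, \<open>r\<close> and
    \<open>p\<close>, \<open>t\<close> cannot both have an upper bound that is incomparable to the
    third point.\<close>
  have exclusive: False
    if prst: "p \<Rrightarrow> s" "r \<Rrightarrow> s" "s \<leadsto> t \<or> t \<leadsto> s" "p \<Rrightarrow> s'" "t \<Rrightarrow> s'" "s' \<leadsto> r \<or> r \<leadsto> s'" for p r t s s'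
  proof -
    have "s \<noteq> s'" using prst redD by blast
    then consider "s \<Rrightarrow> s'" | "s' \<Rrightarrow> s" using chain[of p s s'] prst by blast
    then show False using trans[of r s s'] trans[of t s' s] prst redD by cases blast+
  qed
  obtain d' where d': "c \<leadsto> d'" using vertex_degrees[of c] abc rel_mem by blast
  have below: "x \<leadsto> d'" if "x \<Rrightarrow> c" for x
    using down[OF that, of d'] noP2[of c d' x] d' that by blast
  \<comment> \<open>The triangle \<open>a\<close>, \<open>b\<close>, \<open>d'\<close> with
    \<open>c\<close> above its first two vertices is the model; \<open>hom_transitive\<close>
    carries it to all transitive triangles, so it is always the last vertex that branches
    off.\<close>
  have sink: "\<exists>s. x \<Rrightarrow> s \<and> y \<Rrightarrow> s \<and> (s \<leadsto> z \<or> z \<leadsto> s)" if "x \<leadsto> y" "y \<leadsto> z" "x \<leadsto> z" for x y z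
    using hom_transitive[OF abc(1) below[OF abc(3)] below[OF abc(2)] that] abc d' aut_red aut_blue by metis
  have no_source: False if "x \<leadsto> y" "y \<leadsto> z" "x \<leadsto> z" "y \<Rrightarrow> s" "z \<Rrightarrow> s" "s \<leadsto> x \<or> x \<leadsto> s" for x y z s
    using sink[OF that(1-3)] exclusive[of y _ x z s] that(4-6) by blast
  have no_mid: False if "x \<leadsto> y" "y \<leadsto> z" "x \<leadsto> z" "x \<Rrightarrow> s" "z \<Rrightarrow> s" "s \<leadsto> y \<or> y \<leadsto> s" for x y z s
    using sink[OF that(1-3)] exclusive[of x _ y z s] that(4-6) by blast
  show False
  proof (cases "\<exists>x y z. x \<leadsto> y \<and> y \<leadsto> z \<and> x \<Rrightarrow> z")
    case False
    \<comment> \<open>Without forward paths, \<open>d\<close> has arcs to everything below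
      \<open>c\<close>, so in the triangle \<open>d\<close>, \<open>a\<close>, \<open>b\<close> the
      first vertex branches off.\<close>
    obtain d where d: "d \<leadsto> c" using vertex_degrees[of c] abc rel_mem by blast
    have "d \<leadsto> x" if "x \<Rrightarrow> c" for x
      using down[OF that, of d] False d that by blast
    then show False using no_source[of d a b c] abc d by blast
  next
    case True
    then obtain p q r where pqr: "p \<leadsto> q" "q \<leadsto> r" "p \<Rrightarrow> r" by blast
    have P1: "\<exists>z. y \<leadsto> z \<and> x \<Rrightarrow> z" if "x \<leadsto> y" for x y
      using hom_red[OF pqr(1) that] pqr aut_red aut_blue by metis
    \<comment> \<open>The aim is a point \<open>f\<close> above both \<open>r\<close> and
      \<open>t\<close>, with arcs from \<open>q\<close> to \<open>f\<close> and from
      \<open>t\<close> to \<open>r\<close>. Then \<open>q\<close> branches off from the triangle on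
      \<open>q\<close>, \<open>t\<close>, \<open>r\<close>, although \<open>r\<close> is its last
      vertex.\<close>
    obtain e where e: "r \<leadsto> e" "q \<Rrightarrow> e" using P1[OF pqr(2)] by blast
    obtain f where f: "e \<leadsto> f" "r \<Rrightarrow> f" using P1[OF e(1)] by blast
    have qf: "q \<leadsto> f" using down[OF e(2), of f] noP2[of e f q] f e by blast
    obtain t where t: "t \<leadsto> r" "t \<Rrightarrow> f" using ext1[OF f(2)] by blast
    have "t \<leadsto> q \<or> q \<leadsto> t" using down[OF t(2), of q] qf by blast
    then show False using no_source[of q t r f] no_mid[of t q r f] pqr t f qf by blast
  qed
qed

text \<open>The hypothesis \<open>noP2\<close> is a choice of direction: if one red path runs
  against \<open>B\<close>, then by \<open>hom_path\<close> none with unrelated ends runs along it,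
  and reversing all arcs gives \<open>noP2\<close>.\<close>

lemma no_common_successor:
  assumes abc: "a \<leadsto> b" "a \<Rrightarrow> c" "b \<Rrightarrow> c"
  shows False
proof (cases "\<exists>x y z. x \<leadsto> y \<and> y \<leadsto> z \<and> z \<Rrightarrow> x")
  case False
  then show False using no_common_successor_aux[OF abc] by blast
next
  case True
  then obtain x y z where xyz: "x \<leadsto> y" "y \<leadsto> z" "z \<Rrightarrow> x" by blast
  have "\<not> x' \<Rrightarrow> z'" if "x' \<leadsto> y'" "y' \<leadsto> z'" for x' y' z'
  proof
    assume "x' \<Rrightarrow> z'"
    then have "\<exists>g. aut g \<and> g x' = x \<and> g y' = y \<and> g z' = z"
      using hom_path[of x' y' z' x y z] that xyz by blast
    then obtain g where "aut g" "g x' = x" "g z' = z" by blast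
    then have "x \<Rrightarrow> z" using aut_blue \<open>x' \<Rrightarrow> z'\<close> by metis
    then show False using xyz blue_asym by blast
  qed
  then show False using oriented_digraph.no_common_successor_aux[OF reverse_red, of b a c] abc by simp
qed

lemma no_common_predecessor:
  assumes "a \<leadsto> b" "c \<Rrightarrow> a" "c \<Rrightarrow> b"
  shows False
  using oriented_digraph.no_common_successor[OF reverse_blue, of a b c] assms by simp

end

subsection \<open>The circular case\<close>

locale circular_digraph = oriented_digraph +
  assumes infinite: "infinite V"
    and cyclic_triple_exists: "\<exists>a b c. a \<leadsto> b \<and> b \<Rrightarrow> c \<and> c \<Rrightarrow> a"
begin

section \<open>Excluded triples in the circular case\<close>

text \<open>The one cyclic triple provided by the locale fixes the orientation of all such triples
  through \<open>hom_arc_point\<close>.\<close>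

lemma between:
  assumes "a \<leadsto> b" "a \<parallel> c" "b \<parallel> c"
  shows "b \<Rrightarrow> c \<and> c \<Rrightarrow> a"
proof -
  obtain x y z where "x \<leadsto> y" "y \<Rrightarrow> z" "z \<Rrightarrow> x" using cyclic_triple_exists by blast
  then show ?thesis using hom_arc_point[of x y z a b c] assms aut_blue by metis
qed

lemma between_arc: "a \<leadsto> b \<Longrightarrow> \<exists>c. b \<Rrightarrow> c \<and> c \<Rrightarrow> a"
proof -
  obtain x y z where xyz: "x \<leadsto> y" "y \<Rrightarrow> z" "z \<Rrightarrow> x" using cyclic_triple_exists by blast
  assume "a \<leadsto> b"
  from hom_red[OF xyz(1) this] show ?thesis using xyz aut_blue by metis
qed

lemma continue_blue: "x \<Rrightarrow> y \<Longrightarrow> \<exists>z. y \<Rrightarrow> z \<and> z \<leadsto> x"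
proof -
  obtain a b c where abc: "a \<leadsto> b" "b \<Rrightarrow> c" "c \<Rrightarrow> a" using cyclic_triple_exists by blast
  assume "x \<Rrightarrow> y"
  from hom_blue[OF abc(2) this] show ?thesis using abc aut_blue aut_red by metis
qed

lemma precede_blue: "x \<Rrightarrow> y \<Longrightarrow> \<exists>z. z \<Rrightarrow> x \<and> y \<leadsto> z"
proof -
  obtain a b c where abc: "a \<leadsto> b" "b \<Rrightarrow> c" "c \<Rrightarrow> a" using cyclic_triple_exists by blast
  assume "x \<Rrightarrow> y"
  from hom_blue[OF abc(3) this] show ?thesis using abc aut_blue aut_red by metis
qed

lemma successors_unrelated: "x \<Rrightarrow> u \<Longrightarrow> x \<Rrightarrow> v \<Longrightarrow> u \<noteq> v \<Longrightarrow> u \<parallel> v"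
  using no_common_predecessor[of u v x] no_common_predecessor[of v u x] red_or_unrelated[of u v]
    blue_mem[of x u] blue_mem[of x v] by blast

lemma predecessors_unrelated: "u \<Rrightarrow> x \<Longrightarrow> v \<Rrightarrow> x \<Longrightarrow> u \<noteq> v \<Longrightarrow> u \<parallel> v"
  using no_common_successor[of u v x] no_common_successor[of v u x] red_or_unrelated[of u v]
    blue_mem[of u x] blue_mem[of v x] by blast

text \<open>Infinity enters here. Otherwise each vertex has at most one blue successor and one blue
  predecessor; as a red neighbour is reached in two blue steps, there is at most one in each
  direction too, leaving at most five vertices.\<close>

lemma transitive_triple_exists: "\<exists>x y z. x \<Rrightarrow> y \<and> y \<Rrightarrow> z \<and> x \<Rrightarrow> z"
proof (rule ccontr)
  assume no: "\<not> ?thesis"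
  have out1: "u = v" if "x \<Rrightarrow> u" "x \<Rrightarrow> v" for x u v
    using successors_unrelated[of x u v] that no by blast
  have in1: "u = v" if "u \<Rrightarrow> x" "v \<Rrightarrow> x" for x u v
    using predecessors_unrelated[of u x v] that no by blast
  obtain x where x: "x \<in> V" using infinite by (metis finite.emptyI ex_in_conv)
  have single: "finite {y. P y}" if "\<And>u v. P u \<Longrightarrow> P v \<Longrightarrow> u = v" for P :: "'a \<Rightarrow> bool"
  proof (cases "\<exists>u. P u")
    case True
    then obtain u where "P u" by blast
    then have "{y. P y} \<subseteq> {u}" using that by blast
    then show ?thesis using finite_subset by blast
  qed simp
  have "finite {y. x \<Rrightarrow> y}" by (rule single) (use out1 in blast)
  moreover have "finite {y. y \<Rrightarrow> x}" by (rule single) (use in1 in blast)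
  moreover have "finite {y. y \<leadsto> x}"
  proof (rule single)
    fix u v assume "u \<leadsto> x" "v \<leadsto> x"
    then obtain c c' where "x \<Rrightarrow> c" "c \<Rrightarrow> u" "x \<Rrightarrow> c'" "c' \<Rrightarrow> v" using between_arc by meson
    then show "u = v" using out1 by blast
  qed
  moreover have "finite {y. x \<leadsto> y}"
  proof (rule single)
    fix u v assume "x \<leadsto> u" "x \<leadsto> v"
    then obtain c c' where "c \<Rrightarrow> x" "u \<Rrightarrow> c" "c' \<Rrightarrow> x" "v \<Rrightarrow> c'" using between_arc by meson
    then show "u = v" using in1 by blast
  qed
  ultimately have "finite ({x} \<union> {y. x \<Rrightarrow> y} \<union> {y. y \<Rrightarrow> x} \<union> {y. y \<leadsto> x} \<union> {y. x \<leadsto> y})" by simp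
  moreover have "V \<subseteq> {x} \<union> {y. x \<Rrightarrow> y} \<union> {y. y \<Rrightarrow> x} \<union> {y. y \<leadsto> x} \<union> {y. x \<leadsto> y}"
    using unrelated_blue[OF x] by blast
  ultimately show False using infinite finite_subset by blast
qed

lemma no_blue_cycle: "x \<Rrightarrow> y \<Longrightarrow> y \<Rrightarrow> z \<Longrightarrow> \<not> z \<Rrightarrow> x"
  using transitive_triple_exists independent_triples_alike[of x y z] by blast

text \<open>Choose \<open>d\<close> with \<open>b\<close>, \<open>d\<close>, \<open>a\<close> in
  blue succession. Both \<open>c\<close> and \<open>d\<close> are blue predecessors of
  \<open>a\<close>, hence unrelated, and \<open>between\<close> for the arc from \<open>b\<close> to
  \<open>c\<close> then reverses the blue pair \<open>b\<close>, \<open>d\<close>.\<close>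

lemma no_red_path_against_blue:
  assumes "a \<leadsto> b" "b \<leadsto> c"
  shows "\<not> c \<Rrightarrow> a"
proof
  assume ca: "c \<Rrightarrow> a"
  obtain d where d: "b \<Rrightarrow> d" "d \<Rrightarrow> a" using between_arc[OF assms(1)] by blast
  have "c \<noteq> d" using d assms redD by blast
  then have "c \<parallel> d" using predecessors_unrelated ca d by blast
  then have "d \<Rrightarrow> b" using between[of b c d] assms d by blast
  then show False using d blue_asym by blast
qed

text \<open>Compare \<open>v\<close> with a vertex \<open>u\<close> that continues the arc from
  \<open>z\<close> to \<open>x\<close> to a cyclic triple: each of the four possible relations
  produces an excluded configuration.\<close>

lemma no_transitive_red:
  assumes "z \<leadsto> v" "v \<leadsto> x"
  shows "\<not> z \<leadsto> x"
proof
  assume "z \<leadsto> x"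
  then obtain u where u: "x \<Rrightarrow> u" "u \<Rrightarrow> z" using between_arc by blast
  have "u \<noteq> v" using u assms redD by blast
  then consider "u \<leadsto> v" | "v \<leadsto> u" | "u \<Rrightarrow> v" | "v \<Rrightarrow> u"
    using unrelated_blue[of u v] assms u rel_mem by blast
  then show False
    using no_red_path_against_blue[of u v x] no_red_path_against_blue[of z v u]
      no_common_predecessor[of z v u] no_common_successor[of v x u] u assms by cases blast+
qed

section \<open>Quadrants and their addition modulo 4\<close>

text \<open>The quadrant, counted anticlockwise, in which \<open>y\<close> is seen from \<open>x\<close>; a junk value if \<open>x = y\<close>.\<close>

definition quadrant :: "'a \<Rightarrow> 'a \<Rightarrow> int" where
  "quadrant x y = (if x \<Rrightarrow> y then 0 else if y \<leadsto> x then 1 else if x \<leadsto> y then 2 else 3)"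

lemma quadrant_simps:
  "x \<Rrightarrow> y \<Longrightarrow> quadrant x y = 0" "y \<leadsto> x \<Longrightarrow> quadrant x y = 1"
  "x \<leadsto> y \<Longrightarrow> quadrant x y = 2" "y \<Rrightarrow> x \<Longrightarrow> quadrant x y = 3"
proof -
  show "quadrant x y = 0" if "x \<Rrightarrow> y" using that by (simp add: quadrant_def)
  show "quadrant x y = 1" if "y \<leadsto> x" using that redD[OF that] by (simp add: quadrant_def)
  show "quadrant x y = 2" if "x \<leadsto> y" using that redD[OF that] by (simp add: quadrant_def)
  show "quadrant x y = 3" if "y \<Rrightarrow> x"
    using blue_asym[OF that] blue_unrelated[OF that] by (simp add: quadrant_def)
qed

lemma quadrant_range: "quadrant x y \<in> {0, 1, 2, 3}"
  by (simp add: quadrant_def)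

lemma quadrant_red_iff: "y \<leadsto> x \<longleftrightarrow> quadrant x y = 1"
  using redD[of y x] by (auto simp: quadrant_def)

lemma quadrant_cases:
  assumes "x \<in> V" "y \<in> V" "x \<noteq> y"
  obtains "x \<Rrightarrow> y" "quadrant x y = 0" | "y \<leadsto> x" "quadrant x y = 1"
    | "x \<leadsto> y" "quadrant x y = 2" | "y \<Rrightarrow> x" "quadrant x y = 3"
  using unrelated_blue[OF assms] quadrant_simps(1,3)[of x y] quadrant_simps(2,4)[of y x] by metis

text \<open>A displacement strictly inside quadrant \<open>i\<close> has its negative strictly
  inside quadrant \<open>3 - i\<close>.\<close>

lemma quadrant_swap:
  assumes "x \<in> V" "y \<in> V" "x \<noteq> y"
  shows "quadrant y x = 3 - quadrant x y"
  by (rule quadrant_cases[OF assms]) (simp_all add: quadrant_simps)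

text \<open>Think of each displacement as quadrant plus a fraction of a quarter turn. Two fractions
  add up with carry 0 or 1, and \<open>3\<close> stands for \<open>-1\<close> modulo 4. In the case
  check, every other combination contains one of the six excluded triples.\<close>

lemma quadrant_additive:
  assumes "x \<in> V" "u \<in> V" "v \<in> V" "x \<noteq> u" "u \<noteq> v" "x \<noteq> v"
  shows "(quadrant x u + quadrant u v - quadrant x v) mod 4 \<in> {0, 3}"
proof -
  have F1: "\<lbrakk>a \<Rrightarrow> b; b \<Rrightarrow> c; c \<Rrightarrow> a\<rbrakk> \<Longrightarrow> False" for a b c using no_blue_cycle by blast
  have F2: "\<lbrakk>a \<leadsto> b; b \<leadsto> c; c \<Rrightarrow> a\<rbrakk> \<Longrightarrow> False" for a b c using no_red_path_against_blue by blast
  have F3: "\<lbrakk>a \<leadsto> b; b \<leadsto> c; a \<leadsto> c\<rbrakk> \<Longrightarrow> False" for a b c using no_transitive_red by blast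
  have F4: "\<lbrakk>a \<leadsto> b; a \<Rrightarrow> c; c \<Rrightarrow> b\<rbrakk> \<Longrightarrow> False" for a b c using between blue_asym by blast
  note F = F1 F2 F3 F4 no_common_predecessor no_common_successor
  show ?thesis
    by (rule quadrant_cases[OF assms(1,2,4)]; rule quadrant_cases[OF assms(2,3,5)];
        rule quadrant_cases[OF assms(1,3,6)])
      (simp_all, (erule (2) F[THEN FalseE])+)
qed

end

lemma mod4_reverse:
  "(a + b - c) mod 4 \<in> {0, 3} \<Longrightarrow> (a + b - c) mod 4 = 0 \<longleftrightarrow> \<not> (c + (3 - b) - a) mod 4 = 0" for a b c :: int
  by (simp, presburger)

text \<open>Here and in \<open>mod4_between\<close> the sum of the first two bracketed terms equals
  the sum of the last two, hence is 0 modulo 4; two residues in \<open>{0, 3}\<close> with that sum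
  are both 0.\<close>

lemma mod4_compose:
  "\<lbrakk>(a + e - d) mod 4 \<in> {0, 3}; (b + f - e) mod 4 \<in> {0, 3}; (a + b - c) mod 4 = 0; (c + f - d) mod 4 = 0\<rbrakk>
    \<Longrightarrow> (a + e - d) mod 4 = 0" for a b c d e f :: int
  by (simp, presburger)

lemma mod4_between:
  "\<lbrakk>(a + b - c) mod 4 \<in> {0, 3}; (c + d - e) mod 4 \<in> {0, 3}; (b + d - f) mod 4 = 0; (a + f - e) mod 4 = 0\<rbrakk>
    \<Longrightarrow> (a + b - c) mod 4 = 0 \<and> (c + d - e) mod 4 = 0" for a b c d e f :: int
  by (simp, presburger)

lemma mod4_target:
  "\<lbrakk>(a + b - c) mod 4 = 0; b = (k - a) mod 4; k \<in> {0, 1, 2, 3}; c \<in> {0, 1, 2, 3}\<rbrakk> \<Longrightarrow> c = k" for a b c k :: int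
  by (simp, presburger)

context circular_digraph
begin

section \<open>Completing a pair to a triple\<close>

lemma extend_transitive_triple:
  assumes "x \<Rrightarrow> y"
  shows "\<exists>z. y \<Rrightarrow> z \<and> x \<Rrightarrow> z" "\<exists>z. z \<Rrightarrow> x \<and> z \<Rrightarrow> y"
proof -
  obtain a b c where abc: "a \<Rrightarrow> b" "b \<Rrightarrow> c" "a \<Rrightarrow> c" using transitive_triple_exists by blast
  show "\<exists>z. y \<Rrightarrow> z \<and> x \<Rrightarrow> z" using hom_blue[OF abc(1) assms] abc aut_blue by metis
  show "\<exists>z. z \<Rrightarrow> x \<and> z \<Rrightarrow> y" using hom_blue[OF abc(2) assms] abc aut_blue by metis
qed

text \<open>Continue an arc from \<open>v\<close> to \<open>x\<close> by \<open>u\<close> to a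
  cyclic triple and take a common blue predecessor \<open>w\<close> of \<open>x\<close> and
  \<open>u\<close>. By \<open>between\<close>, the only relation left for \<open>w\<close> and
  \<open>v\<close> is an arc from \<open>v\<close>.\<close>

lemma fork_exists: "\<exists>v w x. v \<leadsto> w \<and> v \<leadsto> x \<and> w \<Rrightarrow> x"
proof -
  obtain v x where vx: "v \<leadsto> x" using red_nonempty by auto
  obtain u where u: "x \<Rrightarrow> u" "u \<Rrightarrow> v" using between_arc[OF vx] by blast
  obtain w where w: "w \<Rrightarrow> x" "w \<Rrightarrow> u" using extend_transitive_triple(2)[OF u(1)] by blast
  have "w \<noteq> v" using w u blue_asym by blast
  moreover have "\<not> w \<parallel> v" using between[of v x w] vx w blue_asym by blast
  moreover have "\<not> w \<leadsto> v" using between[of w v u] u w blue_asym by blast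
  ultimately have "v \<leadsto> w" using red_or_unrelated[of v w] red_mem[OF vx] blue_mem[OF w(1)] by blast
  then show ?thesis using vx w by blast
qed

text \<open>The mirror image of \<open>fork_exists\<close>, with a common blue successor of
  \<open>u\<close> and \<open>v\<close>.\<close>

lemma join_exists: "\<exists>v w x. v \<leadsto> x \<and> w \<leadsto> x \<and> v \<Rrightarrow> w"
proof -
  obtain v x where vx: "v \<leadsto> x" using red_nonempty by auto
  obtain u where u: "x \<Rrightarrow> u" "u \<Rrightarrow> v" using between_arc[OF vx] by blast
  obtain w where w: "v \<Rrightarrow> w" "u \<Rrightarrow> w" using extend_transitive_triple(1)[OF u(2)] by blast
  have "w \<noteq> x" using w u blue_asym by blast
  moreover have "\<not> w \<parallel> x" using between[of v x w] vx w blue_asym by blast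
  moreover have "\<not> x \<leadsto> w" using between[of x w u] u w blue_asym by blast
  ultimately have "w \<leadsto> x" using red_or_unrelated[of x w] red_mem[OF vx] blue_mem[OF w(1)] by blast
  then show ?thesis using vx w by blast
qed

lemma extend_to_fork:
  "w \<Rrightarrow> x \<Longrightarrow> \<exists>v. v \<leadsto> w \<and> v \<leadsto> x" "v \<leadsto> w \<Longrightarrow> \<exists>x. v \<leadsto> x \<and> w \<Rrightarrow> x"
proof -
  obtain a b c where abc: "a \<leadsto> b" "a \<leadsto> c" "b \<Rrightarrow> c" using fork_exists by blast
  show "\<exists>v. v \<leadsto> w \<and> v \<leadsto> x" if "w \<Rrightarrow> x" using hom_blue[OF abc(3) that] abc aut_red by metis
  show "\<exists>x. v \<leadsto> x \<and> w \<Rrightarrow> x" if "v \<leadsto> w" using hom_red[OF abc(1) that] abc aut_red aut_blue by metis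
qed

lemma extend_to_join:
  "v \<Rrightarrow> w \<Longrightarrow> \<exists>x. v \<leadsto> x \<and> w \<leadsto> x" "w \<leadsto> x \<Longrightarrow> \<exists>v. v \<leadsto> x \<and> v \<Rrightarrow> w"
proof -
  obtain a b c where abc: "a \<leadsto> c" "b \<leadsto> c" "a \<Rrightarrow> b" using join_exists by blast
  show "\<exists>x. v \<leadsto> x \<and> w \<leadsto> x" if "v \<Rrightarrow> w" using hom_blue[OF abc(3) that] abc aut_red by metis
  show "\<exists>v. v \<leadsto> x \<and> v \<Rrightarrow> w" if "w \<leadsto> x" using hom_red[OF abc(2) that] abc aut_red aut_blue by metis
qed

section \<open>The dense order of the vertices seen from a base point\<close>

text \<open>The anticlockwise order of the points other than \<open>x\<close>, after all of them have been rotated by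
  multiples of \<open>\<pi>/2\<close> into the first quadrant as seen from \<open>x\<close>.\<close>

definition before :: "'a \<Rightarrow> 'a \<Rightarrow> 'a \<Rightarrow> bool" where
  "before x u v \<longleftrightarrow> u \<noteq> v \<and> (quadrant x u + quadrant u v - quadrant x v) mod 4 = 0"

lemma quadrant_bounds: "0 \<le> quadrant x y" "quadrant x y \<le> 3"
  by (auto simp: quadrant_def)

text \<open>By \<open>quadrant_swap\<close>, interchanging \<open>u\<close> and \<open>v\<close>
  turns the residue \<open>r\<close> into \<open>3 - r\<close>, so exactly one of the two directions
  has residue 0.\<close>

lemma before_linear:
  assumes "x \<in> V" "u \<in> V" "v \<in> V" "x \<noteq> u" "u \<noteq> v" "x \<noteq> v"
  shows "before x u v \<longleftrightarrow> \<not> before x v u"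
  using mod4_reverse[OF quadrant_additive[OF assms]] quadrant_swap[OF assms(2,3,5)] assms(5)
  unfolding before_def by simp

lemma before_trans:
  assumes "x \<in> V" "u \<in> V" "v \<in> V" "w \<in> V" "x \<noteq> u" "x \<noteq> v" "x \<noteq> w"
    and "before x u v" "before x v w"
  shows "before x u w"
proof -
  have "u \<noteq> v" "v \<noteq> w" using assms by (auto simp: before_def)
  have "u \<noteq> w" using before_linear[of x u v] assms \<open>u \<noteq> v\<close> by blast
  have "(quadrant x u + quadrant u w - quadrant x w) mod 4 = 0"
    by (rule mod4_compose[OF quadrant_additive[of x u w] quadrant_additive[of u v w]])
      (use assms \<open>u \<noteq> v\<close> \<open>v \<noteq> w\<close> \<open>u \<noteq> w\<close> in \<open>auto simp: before_def\<close>)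
  then show ?thesis using \<open>u \<noteq> w\<close> by (simp add: before_def)
qed

text \<open>The order \<open>lt\<close> is a parameter because the notion is used for
  \<open>before x\<close> and for its converse.\<close>

definition cofinal :: "'a \<Rightarrow> ('a \<Rightarrow> 'a \<Rightarrow> bool) \<Rightarrow> int \<Rightarrow> int \<Rightarrow> bool" where
  "cofinal x lt i k \<longleftrightarrow> (\<forall>u\<in>V - {x}. quadrant x u = i \<longrightarrow> (\<exists>w\<in>V - {x}. quadrant x w = k \<and> lt u w))"

lemma cofinalI:
  assumes "\<And>u. u \<in> V \<Longrightarrow> u \<noteq> x \<Longrightarrow> quadrant x u = i \<Longrightarrow> \<exists>w\<in>V. w \<noteq> x \<and> quadrant x w = k \<and> lt u w"
  shows "cofinal x lt i k"
  using assms unfolding cofinal_def by blast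

lemma cofinal_trans:
  assumes "cofinal x lt i j" "cofinal x lt j k"
    and "\<And>u v w. \<lbrakk>u \<in> V - {x}; v \<in> V - {x}; w \<in> V - {x}; lt u v; lt v w\<rbrakk> \<Longrightarrow> lt u w"
  shows "cofinal x lt i k"
  using assms unfolding cofinal_def by meson

lemma quadrantD:
  assumes "x \<in> V" "y \<in> V" "x \<noteq> y"
  shows "quadrant x y = 0 \<Longrightarrow> x \<Rrightarrow> y" "quadrant x y = 1 \<Longrightarrow> y \<leadsto> x"
    "quadrant x y = 2 \<Longrightarrow> x \<leadsto> y" "quadrant x y = 3 \<Longrightarrow> y \<Rrightarrow> x"
  by (rule quadrant_cases[OF assms]; simp)+

text \<open>The pairs of quadrants are the links of the chain 1, 0, 3, 2, in both directions. In
  each case a three-point completion of the pair \<open>x\<close>, \<open>u\<close> supplies the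
  witness.\<close>

lemma cofinal_adjacent:
  assumes x: "x \<in> V"
  shows "cofinal x (before x) 0 1" "cofinal x (before x) 1 0" "cofinal x (before x) 2 3"
    "cofinal x (before x) 3 2" "cofinal x (before x) 3 0" "cofinal x (before x) 0 3"
    "cofinal x (\<lambda>u v. before x v u) 0 1" "cofinal x (\<lambda>u v. before x v u) 1 0"
    "cofinal x (\<lambda>u v. before x v u) 2 3" "cofinal x (\<lambda>u v. before x v u) 3 2"
    "cofinal x (\<lambda>u v. before x v u) 3 0" "cofinal x (\<lambda>u v. before x v u) 0 3"
proof -
  show "cofinal x (before x) 0 1"
  proof (rule cofinalI)
    fix u assume u: "u \<in> V" "u \<noteq> x" "quadrant x u = 0"
    then have "x \<Rrightarrow> u" using quadrantD x by blast
    then obtain w where w: "w \<leadsto> x" "w \<leadsto> u" using extend_to_fork(1) by blast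
    then show "\<exists>w\<in>V. w \<noteq> x \<and> quadrant x w = 1 \<and> before x u w"
      using u redD[OF w(1)] redD[OF w(2)] by (intro bexI[of _ w]) (auto simp: before_def quadrant_simps)
  qed
  show "cofinal x (before x) 1 0"
  proof (rule cofinalI)
    fix u assume u: "u \<in> V" "u \<noteq> x" "quadrant x u = 1"
    then have "u \<leadsto> x" using quadrantD x by blast
    then obtain w where w: "x \<Rrightarrow> w" "w \<Rrightarrow> u" using between_arc by blast
    then show "\<exists>w\<in>V. w \<noteq> x \<and> quadrant x w = 0 \<and> before x u w"
      using u unrelatedD[of x w] unrelatedD[of w u] by (intro bexI[of _ w]) (auto simp: before_def quadrant_simps)
  qed
  show "cofinal x (before x) 2 3"
  proof (rule cofinalI)
    fix u assume u: "u \<in> V" "u \<noteq> x" "quadrant x u = 2"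
    then have "x \<leadsto> u" using quadrantD x by blast
    then obtain w where w: "w \<leadsto> u" "w \<Rrightarrow> x" using extend_to_join(2) by blast
    then show "\<exists>w\<in>V. w \<noteq> x \<and> quadrant x w = 3 \<and> before x u w"
      using u redD[OF w(1)] unrelatedD[of w x] by (intro bexI[of _ w]) (auto simp: before_def quadrant_simps)
  qed
  show "cofinal x (before x) 3 2"
  proof (rule cofinalI)
    fix u assume u: "u \<in> V" "u \<noteq> x" "quadrant x u = 3"
    then have "u \<Rrightarrow> x" using quadrantD x by blast
    then obtain w where w: "w \<Rrightarrow> u" "x \<leadsto> w" using precede_blue by blast
    then show "\<exists>w\<in>V. w \<noteq> x \<and> quadrant x w = 2 \<and> before x u w"
      using u redD[OF w(2)] unrelatedD[of w u] by (intro bexI[of _ w]) (auto simp: before_def quadrant_simps)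
  qed
  show "cofinal x (before x) 3 0"
  proof (rule cofinalI)
    fix u assume u: "u \<in> V" "u \<noteq> x" "quadrant x u = 3"
    then have "u \<Rrightarrow> x" using quadrantD x by blast
    then obtain w where w: "x \<Rrightarrow> w" "w \<leadsto> u" using continue_blue by blast
    then show "\<exists>w\<in>V. w \<noteq> x \<and> quadrant x w = 0 \<and> before x u w"
      using u redD[OF w(2)] unrelatedD[of x w] by (intro bexI[of _ w]) (auto simp: before_def quadrant_simps)
  qed
  show "cofinal x (before x) 0 3"
  proof (rule cofinalI)
    fix u assume u: "u \<in> V" "u \<noteq> x" "quadrant x u = 0"
    then have "x \<Rrightarrow> u" using quadrantD x by blast
    then obtain w where w: "w \<Rrightarrow> x" "w \<Rrightarrow> u" using extend_transitive_triple(2) by blast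
    then show "\<exists>w\<in>V. w \<noteq> x \<and> quadrant x w = 3 \<and> before x u w"
      using u unrelatedD[of w x] unrelatedD[of w u] by (intro bexI[of _ w]) (auto simp: before_def quadrant_simps)
  qed
  show "cofinal x (\<lambda>u v. before x v u) 0 1"
  proof (rule cofinalI)
    fix u assume u: "u \<in> V" "u \<noteq> x" "quadrant x u = 0"
    then have "x \<Rrightarrow> u" using quadrantD x by blast
    then obtain w where w: "u \<Rrightarrow> w" "w \<leadsto> x" using continue_blue by blast
    then show "\<exists>w\<in>V. w \<noteq> x \<and> quadrant x w = 1 \<and> before x w u"
      using u redD[OF w(2)] unrelatedD[of u w] by (intro bexI[of _ w]) (auto simp: before_def quadrant_simps)
  qed
  show "cofinal x (\<lambda>u v. before x v u) 1 0"
  proof (rule cofinalI)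
    fix u assume u: "u \<in> V" "u \<noteq> x" "quadrant x u = 1"
    then have "u \<leadsto> x" using quadrantD x by blast
    then obtain w where w: "u \<leadsto> w" "x \<Rrightarrow> w" using extend_to_fork(2) by blast
    then show "\<exists>w\<in>V. w \<noteq> x \<and> quadrant x w = 0 \<and> before x w u"
      using u redD[OF w(1)] unrelatedD[of x w] by (intro bexI[of _ w]) (auto simp: before_def quadrant_simps)
  qed
  show "cofinal x (\<lambda>u v. before x v u) 2 3"
  proof (rule cofinalI)
    fix u assume u: "u \<in> V" "u \<noteq> x" "quadrant x u = 2"
    then have "x \<leadsto> u" using quadrantD x by blast
    then obtain w where w: "u \<Rrightarrow> w" "w \<Rrightarrow> x" using between_arc by blast
    then show "\<exists>w\<in>V. w \<noteq> x \<and> quadrant x w = 3 \<and> before x w u"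
      using u unrelatedD[of u w] unrelatedD[of w x] by (intro bexI[of _ w]) (auto simp: before_def quadrant_simps)
  qed
  show "cofinal x (\<lambda>u v. before x v u) 3 2"
  proof (rule cofinalI)
    fix u assume u: "u \<in> V" "u \<noteq> x" "quadrant x u = 3"
    then have "u \<Rrightarrow> x" using quadrantD x by blast
    then obtain w where w: "u \<leadsto> w" "x \<leadsto> w" using extend_to_join(1) by blast
    then show "\<exists>w\<in>V. w \<noteq> x \<and> quadrant x w = 2 \<and> before x w u"
      using u redD[OF w(1)] redD[OF w(2)] by (intro bexI[of _ w]) (auto simp: before_def quadrant_simps)
  qed
  show "cofinal x (\<lambda>u v. before x v u) 3 0"
  proof (rule cofinalI)
    fix u assume u: "u \<in> V" "u \<noteq> x" "quadrant x u = 3"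
    then have "u \<Rrightarrow> x" using quadrantD x by blast
    then obtain w where w: "x \<Rrightarrow> w" "u \<Rrightarrow> w" using extend_transitive_triple(1) by blast
    then show "\<exists>w\<in>V. w \<noteq> x \<and> quadrant x w = 0 \<and> before x w u"
      using u unrelatedD[of x w] unrelatedD[of u w] by (intro bexI[of _ w]) (auto simp: before_def quadrant_simps)
  qed
  show "cofinal x (\<lambda>u v. before x v u) 0 3"
  proof (rule cofinalI)
    fix u assume u: "u \<in> V" "u \<noteq> x" "quadrant x u = 0"
    then have "x \<Rrightarrow> u" using quadrantD x by blast
    then obtain w where w: "w \<Rrightarrow> x" "u \<leadsto> w" using precede_blue by blast
    then show "\<exists>w\<in>V. w \<noteq> x \<and> quadrant x w = 3 \<and> before x w u"
      using u redD[OF w(2)] unrelatedD[of w x] by (intro bexI[of _ w]) (auto simp: before_def quadrant_simps)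
  qed
qed

text \<open>Every quadrant is linked to quadrant 0 and back; quadrant 0 reaches itself by way of
  quadrant 1.\<close>

lemma cofinal_all:
  assumes adj: "cofinal x lt 0 1" "cofinal x lt 1 0" "cofinal x lt 2 3" "cofinal x lt 3 2"
      "cofinal x lt 3 0" "cofinal x lt 0 3"
    and tr: "\<And>u v w. \<lbrakk>u \<in> V - {x}; v \<in> V - {x}; w \<in> V - {x}; lt u v; lt v w\<rbrakk> \<Longrightarrow> lt u w"
    and ik: "i \<in> {0, 1, 2, 3}" "k \<in> {0, 1, 2, 3}"
  shows "cofinal x lt i k"
proof -
  have t: "cofinal x lt i j \<Longrightarrow> cofinal x lt j k \<Longrightarrow> cofinal x lt i k" for i j k
    using cofinal_trans[of x lt i j k] tr by blast
  have to0: "cofinal x lt i 0" if "i \<in> {0, 1, 2, 3}" for i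
    using that adj t[of 0 1 0] t[of 2 3 0] by auto
  have from0: "cofinal x lt 0 k" if "k \<in> {0, 1, 2, 3}" for k
    using that adj t[of 0 1 0] t[of 0 3 2] by auto
  show ?thesis using t[OF to0 from0] ik by blast
qed

lemma after_exists:
  assumes "x \<in> V" "u \<in> V" "u \<noteq> x" "k \<in> {0, 1, 2, 3}"
  shows "\<exists>w\<in>V. w \<noteq> x \<and> quadrant x w = k \<and> before x u w"
proof -
  have "cofinal x (before x) (quadrant x u) k"
    by (rule cofinal_all[OF cofinal_adjacent(1-6)]) (use assms before_trans[of x] quadrant_range in auto)
  then show ?thesis using assms by (auto simp: cofinal_def)
qed

lemma before_exists:
  assumes "x \<in> V" "u \<in> V" "u \<noteq> x" "k \<in> {0, 1, 2, 3}"
  shows "\<exists>w\<in>V. w \<noteq> x \<and> quadrant x w = k \<and> before x w u"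
proof -
  have "cofinal x (\<lambda>u v. before x v u) (quadrant x u) k"
    by (rule cofinal_all[OF cofinal_adjacent(7-12)]) (use assms before_trans[of x] quadrant_range in auto)
  then show ?thesis using assms by (auto simp: cofinal_def)
qed

text \<open>Lying between \<open>u\<close> and \<open>v\<close> as seen from \<open>x\<close> amounts to lying before \<open>v\<close> as seen from \<open>u\<close>.\<close>

lemma before_dense:
  assumes "x \<in> V" "u \<in> V" "v \<in> V" "u \<noteq> x" "v \<noteq> x" "before x u v" "k \<in> {0, 1, 2, 3}"
  shows "\<exists>w\<in>V. w \<noteq> x \<and> quadrant x w = k \<and> before x u w \<and> before x w v"
proof -
  have uv: "u \<noteq> v" using assms by (auto simp: before_def)
  \<comment> \<open>The quadrant in which \<open>w\<close> must be seen from \<open>u\<close> so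
    that, with carry 0, it is seen from \<open>x\<close> in quadrant \<open>k\<close>.\<close>
  define m where "m = (k - quadrant x u) mod 4"
  have m: "m \<in> {0, 1, 2, 3}" unfolding m_def by auto
  obtain w where w: "w \<in> V" "w \<noteq> u" "quadrant u w = m" "before u w v"
    using before_exists[OF assms(2,3) uv[symmetric] m] by blast
  have wv: "w \<noteq> v" using w by (auto simp: before_def)
  \<comment> \<open>If \<open>w\<close> were \<open>x\<close>, two terms that vanish modulo 4 would
    add up to 3.\<close>
  have wx: "w \<noteq> x"
  proof
    assume "w = x"
    then have "before u x v" using w by simp
    moreover have "quadrant u x = 3 - quadrant x u" using quadrant_swap[of x u] assms by auto
    ultimately have "(3 - quadrant x u + quadrant x v - quadrant u v) mod 4 = 0" by (simp add: before_def)
    moreover have "(quadrant x u + quadrant u v - quadrant x v) mod 4 = 0" using assms by (simp add: before_def)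
    ultimately have "(3 - quadrant x u + quadrant x v - quadrant u v + (quadrant x u + quadrant u v - quadrant x v)) mod 4 = 0"
      by (metis mod_add_eq add_0 mod_0)
    then show False by simp
  qed
  have 1: "(quadrant x u + quadrant u w - quadrant x w) mod 4 \<in> {0, 3}"
    using quadrant_additive[of x u w] assms w wx by auto
  have 2: "(quadrant x w + quadrant w v - quadrant x v) mod 4 \<in> {0, 3}"
    using quadrant_additive[of x w v] assms w wx wv by auto
  have 3: "(quadrant u w + quadrant w v - quadrant u v) mod 4 = 0" using w by (simp add: before_def)
  have 4: "(quadrant x u + quadrant u v - quadrant x v) mod 4 = 0" using assms by (simp add: before_def)
  \<comment> \<open>The carries at \<open>u\<close>, \<open>w\<close>, \<open>v\<close> and at
    \<open>x\<close>, \<open>u\<close>, \<open>v\<close> vanish, hence so do those of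
    \<open>w\<close> relative to \<open>x\<close>.\<close>
  note 5 = mod4_between[OF 1 2 3 4]
  have "quadrant x w = k"
    using mod4_target[OF conjunct1[OF 5] _ assms(7) quadrant_range] w(3) by (simp add: m_def)
  then show ?thesis using w wx wv 5 by (auto simp: before_def)
qed

end

section \<open>Placing the vertices on the unit circle\<close>

lemma Arg2pi_cis:
  assumes "0 \<le> t" "t < 2 * pi"
  shows "Arg2pi (cis (t + 2 * pi * of_int n)) = t"
proof -
  have "cis (t + 2 * pi * of_int n) = cis t"
    by (simp flip: cis_mult)
  then show ?thesis
    using Arg2pi_unique[of 1 t "cis t"] assms by (simp add: cis_conv_exp)
qed

context circular_digraph
begin

text \<open>Cantor's theorem turns \<open>before o'\<close> into the rationals of the unit interval.
  Quadrant plus this rational, in quarter turns, is the position of a vertex relative to the base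
  point \<open>o'\<close>.\<close>

lemma is_T4:
  assumes count: "countable V"
  shows "is_T4 V R"
proof -
  obtain o' where o': "o' \<in> V" using infinite by (metis finite.emptyI ex_in_conv)
  let ?W = "V - {o'}"
  have ord: "dense_unbounded_order ?W (before o')"
    unfolding dense_unbounded_order_def
  proof (intro conjI ballI impI)
    show "?W \<noteq> {}" using infinite by (metis finite.emptyI finite.insertI finite_Diff_insert finite_Diff2 )
    show "\<not> before o' x x" for x by (simp add: before_def)
    show "before o' x z" if "x \<in> ?W" "y \<in> ?W" "z \<in> ?W" "before o' x y" "before o' y z" for x y z
      using before_trans[of o' x y z] o' that by auto
    show "before o' x y \<or> before o' y x" if "x \<in> ?W" "y \<in> ?W" "x \<noteq> y" for x y
      using before_linear[of o' x y] o' that by auto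
    show "\<exists>z\<in>?W. before o' x z \<and> before o' z y" if "x \<in> ?W" "y \<in> ?W" "before o' x y" for x y
      using before_dense[of o' x y 0] o' that by auto
    show "\<exists>y\<in>?W. before o' x y" "\<exists>y\<in>?W. before o' y x" if "x \<in> ?W" for x
      using after_exists[of o' x 0] before_exists[of o' x 0] o' that by auto
  qed
  obtain f where f: "bij_betw f ?W {0<..<1::rat}"
    and f_less: "\<And>x y. x \<in> ?W \<Longrightarrow> y \<in> ?W \<Longrightarrow> before o' x y \<longleftrightarrow> f x < f y"
    by (rule countable_dense_orders_isomorphic[OF ord countable_Diff[OF count]
        dense_unbounded_order_rat_unit countableI_type]) blast
  have f01: "0 < f x \<and> f x < 1" if "x \<in> ?W" for x using f that by (auto dest: bij_betwE)
  define p :: "'a \<Rightarrow> real" where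
    "p x = (if x = o' then 0 else of_int (quadrant o' x) + of_rat (f x))" for x
  define z where "z x = cis (pi / 2 * p x)" for x
  \<comment> \<open>\<open>s\<close> is the fractional part of the displacement from
    \<open>x\<close> to \<open>y\<close>, and \<open>n\<close> counts full turns.\<close>
  have pos: "\<exists>s n. 0 < s \<and> s < 1 \<and> p y - p x = of_int (quadrant x y) + s + 4 * of_int n"
    if xy: "x \<in> V" "y \<in> V" "x \<noteq> y" for x y
  proof -
    consider "x = o'" | "y = o'" "x \<noteq> o'" | "x \<noteq> o'" "y \<noteq> o'" by blast
    then show ?thesis
    proof cases
      case 1
      then show ?thesis using f01[of y] xy
        by (intro exI[of _ "of_rat (f y)"] exI[of _ 0]) (auto simp: p_def)
    next
      case 2
      then show ?thesis using f01[of x] xy quadrant_swap[of x o']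
        by (intro exI[of _ "1 - of_rat (f x)"] exI[of _ "-1"]) (auto simp: p_def)
    next
      case 3
      let ?d = "of_rat (f y) - of_rat (f x) :: real"
      have W: "x \<in> ?W" "y \<in> ?W" using 3 xy by auto
      have d: "-1 < ?d" "?d < 1" using f01[OF W(1)] f01[OF W(2)]
        by (smt (verit) of_rat_less_1_iff zero_less_of_rat_iff)+
      \<comment> \<open>The order seen from \<open>o'\<close> decides the carry: the fractional part
        is the difference of the two rationals, increased by 1 if \<open>y\<close> comes
        first.\<close>
      show ?thesis
      proof (cases "before o' x y")
        case True
        then have "?d > 0" using f_less[OF W] by (simp add: of_rat_less)
        have "4 dvd (quadrant o' x + quadrant x y - quadrant o' y)"
          using True by (simp add: before_def mod_eq_0_iff_dvd)
        then obtain n where "quadrant o' x + quadrant x y - quadrant o' y = 4 * n" ..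
        then have "quadrant o' y = quadrant o' x + quadrant x y - 4 * n" by simp
        then have "p y - p x = of_int (quadrant x y) + ?d + 4 * of_int (- n)"
          using 3 by (simp add: p_def)
        then show ?thesis using d \<open>?d > 0\<close> by blast
      next
        case False
        then have yx: "before o' y x" using before_linear[of o' x y] o' 3 xy by auto
        then have "?d < 0" using f_less[OF W(2,1)] by (simp add: of_rat_less)
        have "4 dvd (quadrant o' y + (3 - quadrant x y) - quadrant o' x)"
          using yx quadrant_swap[of x y] xy by (simp add: before_def mod_eq_0_iff_dvd)
        then obtain n where "quadrant o' y + (3 - quadrant x y) - quadrant o' x = 4 * n" ..
        then have "quadrant o' y = 4 * n - 3 + quadrant x y + quadrant o' x" by simp
        then have "p y - p x = of_int (quadrant x y) + (1 + ?d) + 4 * of_int (n - 1)"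
          using 3 by (simp add: p_def)
        moreover have "0 < 1 + ?d" "1 + ?d < 1" using d \<open>?d < 0\<close> by auto
        ultimately show ?thesis by blast
      qed
    qed
  qed
  have arg: "\<exists>s. 0 < s \<and> s < 1 \<and> Arg2pi (z y / z x) = pi / 2 * (of_int (quadrant x y) + s)"
    if xy: "x \<in> V" "y \<in> V" "x \<noteq> y" for x y
  proof -
    obtain s n where s: "0 < s" "s < 1" "p y - p x = of_int (quadrant x y) + s + 4 * of_int n"
      using pos[OF xy] by blast
    let ?t = "pi / 2 * (of_int (quadrant x y) + s)"
    have "real_of_int (quadrant x y) \<le> 3" "0 \<le> real_of_int (quadrant x y)"
      using quadrant_bounds[of x y] by auto
    then have "0 \<le> ?t" "?t < 2 * pi" using s by (auto simp: mult_less_cancel_left)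
    moreover have "pi / 2 * p y - pi / 2 * p x = ?t + 2 * pi * of_int n"
      using s(3) by (simp flip: right_diff_distrib) (simp add: algebra_simps)
    then have "z y / z x = cis (?t + 2 * pi * of_int n)" by (simp only: z_def cis_divide)
    ultimately show ?thesis using Arg2pi_cis[of ?t n] s by auto
  qed
  have arg_gt: "Arg2pi (z y / z x) > 0" "Arg2pi (z y / z x) \<noteq> pi / 2" "Arg2pi (z y / z x) \<noteq> pi"
    "pi / 2 < Arg2pi (z y / z x) \<and> Arg2pi (z y / z x) < pi \<longleftrightarrow> y \<leadsto> x"
    if xy: "x \<in> V" "y \<in> V" "x \<noteq> y" for x y
  proof -
    obtain s where s: "0 < s" "s < 1" "Arg2pi (z y / z x) = pi / 2 * (of_int (quadrant x y) + s)"
      using arg[OF xy] by blast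
    let ?a = "real_of_int (quadrant x y) + s"
    \<comment> \<open>The values 0, 1, 2 of \<open>c\<close> turn comparisons with the angles 0,
      \<open>pi / 2\<close> and \<open>pi\<close> into comparisons with integers.\<close>
    have "pi / 2 * ?a > pi / 2 * c \<longleftrightarrow> ?a > c" "pi / 2 * ?a < pi / 2 * c \<longleftrightarrow> ?a < c"
      "pi / 2 * ?a = pi / 2 * c \<longleftrightarrow> ?a = c" for c
      by (simp_all only: mult_less_cancel_left_pos mult_cancel_left pi_half_gt_zero) simp
    from this[of 0] this[of 1] this[of 2]
    have *: "Arg2pi (z y / z x) > 0 \<longleftrightarrow> ?a > 0" "Arg2pi (z y / z x) = pi / 2 \<longleftrightarrow> ?a = 1"
      "Arg2pi (z y / z x) = pi \<longleftrightarrow> ?a = 2" "pi / 2 < Arg2pi (z y / z x) \<longleftrightarrow> 1 < ?a"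
      "Arg2pi (z y / z x) < pi \<longleftrightarrow> ?a < 2"
      unfolding s(3) by simp_all
    have "quadrant x y = 0 \<or> quadrant x y = 1 \<or> quadrant x y = 2 \<or> quadrant x y = 3"
      using quadrant_range[of x y] by simp
    then show "Arg2pi (z y / z x) > 0" "Arg2pi (z y / z x) \<noteq> pi / 2" "Arg2pi (z y / z x) \<noteq> pi"
      "pi / 2 < Arg2pi (z y / z x) \<and> Arg2pi (z y / z x) < pi \<longleftrightarrow> y \<leadsto> x"
      unfolding * quadrant_red_iff using s by auto
  qed
  have z0: "z x \<noteq> 0" for x by (simp add: z_def)
  have self: "Arg2pi (z x / z x) = 0" for x using z0 Arg2pi_of_real[of 1] by simp
  \<comment> \<open>Distinct vertices have a positive angle between them, whereas a point makes the
    angle 0 with itself.\<close>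
  have inj: "inj_on z V"
  proof (rule inj_onI)
    fix x y assume "x \<in> V" "y \<in> V" "z x = z y"
    then show "x = y" using arg_gt(1)[of x y] self[of x] by force
  qed
  have "T4_vertices (z ` V)"
    unfolding T4_vertices_def
  proof (intro conjI ballI)
    show "countable (z ` V)" using count by simp
    show "z ` V \<subseteq> sphere 0 1" by (auto simp: z_def)
    fix x y assume "x \<in> z ` V" "y \<in> z ` V"
    then obtain x' y' where xy: "x' \<in> V" "y' \<in> V" "x = z x'" "y = z y'" by blast
    show "Arg2pi (y / x) \<noteq> pi / 2" "Arg2pi (y / x) \<noteq> pi"
      using arg_gt(2,3)[of x' y'] xy self[of x'] by (cases "x' = y'"; simp)+
  next
    show "sphere 0 1 \<subseteq> closure (z ` V)"
    proof
      fix c :: complex assume "c \<in> sphere 0 1"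
      then have c: "c = cis (Arg2pi c)" by (simp add: complex_norm_eq_1_exp cis_conv_exp)
      \<comment> \<open>The point \<open>c\<close> sits \<open>k + t\<close> quarter turns from the
        base point; a vertex of quadrant \<open>k\<close> with rational close to \<open>t\<close>
        approximates it.\<close>
      define a where "a = Arg2pi c / (pi / 2)"
      define k where "k = \<lfloor>a\<rfloor>"
      define t where "t = a - of_int k"
      have t: "0 \<le> t" "t < 1" unfolding t_def k_def by linarith+
      have "0 \<le> a" "a < 4" using Arg2pi_ge_0[of c] Arg2pi_lt_2pi[of c] by (auto simp: a_def field_simps)
      then have "0 \<le> k" "k < 4" unfolding k_def by linarith+
      then have k: "k \<in> {0, 1, 2, 3}" by auto
      have ca: "c = cis (pi / 2 * (of_int k + t))" using c by (simp add: t_def a_def)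
      show "c \<in> closure (z ` V)"
        unfolding closure_approachable
      proof (intro allI impI)
        fix e :: real assume "e > 0"
        have "continuous_on UNIV (\<lambda>s. cis (pi / 2 * (of_int k + s)))" by (intro continuous_intros)
        then obtain d where d: "d > 0"
          "\<And>s. dist s t < d \<Longrightarrow> dist (cis (pi / 2 * (of_int k + s))) (cis (pi / 2 * (of_int k + t))) < e"
          using \<open>e > 0\<close> unfolding continuous_on_iff by blast
        \<comment> \<open>The window is cut to the unit interval, where \<open>f\<close> takes its
          values; it stays nonempty as \<open>t\<close> may be 0 but not 1. Two rationals in it give
          vertices \<open>u\<close>, \<open>v\<close>, and \<open>before_dense\<close> finds a
          vertex of quadrant \<open>k\<close> between them.\<close>
        have "max 0 (t - d) < min 1 (t + d)" using t d by auto
        then obtain q1 where q1: "max 0 (t - d) < of_rat q1" "of_rat q1 < min 1 (t + d)"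
          using of_rat_dense by blast
        obtain q2 where q2: "real_of_rat q1 < of_rat q2" "of_rat q2 < min 1 (t + d)"
          using of_rat_dense[OF q1(2)] by blast
        have q: "0 < q1" "q1 < q2" "q2 < 1" using q1 q2 by (auto simp: of_rat_less)
        then have "q1 \<in> f ` ?W" "q2 \<in> f ` ?W" using f by (auto simp: bij_betw_def)
        then obtain u v where uv: "u \<in> ?W" "v \<in> ?W" "f u = q1" "f v = q2" by blast
        then have "before o' u v" using f_less q by auto
        then obtain w where w: "w \<in> V" "w \<noteq> o'" "quadrant o' w = k" "before o' u w" "before o' w v"
          using before_dense[of o' u v k] o' uv k by auto
        then have "q1 < f w" "f w < q2" using f_less[of u w] f_less[of w v] uv by auto
        then have "real_of_rat q1 < of_rat (f w)" "real_of_rat (f w) < of_rat q2" by (auto simp: of_rat_less)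
        then have "dist (of_rat (f w)) t < d" using q1 q2 by (auto simp: dist_real_def)
        then have "dist (z w) c < e" using d(2)[of "of_rat (f w)"] w ca by (simp add: z_def p_def)
        then show "\<exists>y\<in>z ` V. dist y c < e" using w by blast
      qed
    qed
  qed
  moreover have "digraph_iso V R (z ` V) (T4_rel (z ` V)) z"
    unfolding digraph_iso_def
  proof (intro conjI ballI)
    show "bij_betw z V (z ` V)" using inj by (rule inj_on_imp_bij_betw)
    fix x y assume "x \<in> V" "y \<in> V"
    then show "x \<leadsto> y \<longleftrightarrow> (z x, z y) \<in> T4_rel (z ` V)"
      using arg_gt(4)[of y x] self[of x] red_irrefl[of x] by (cases "x = y") (auto simp: T4_rel_def)
  qed
  ultimately show ?thesis unfolding is_T4_def isomorphic_digraphs_def by blast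
qed

end

subsection \<open>The case where unrelatedness is transitive\<close>

text \<open>Without such paths, unrelated vertices have the same red predecessors and successors.
  Transposing two of them is then an automorphism that reverses a blue pair.\<close>

lemma (in oriented_digraph) path_exists:
  assumes equiv: "\<And>x y z. x \<parallel> y \<Longrightarrow> y \<parallel> z \<Longrightarrow> x \<noteq> z \<Longrightarrow> x \<parallel> z"
  shows "\<exists>a b c. a \<leadsto> b \<and> b \<leadsto> c \<and> a \<parallel> c"
proof (rule ccontr)
  assume no: "\<not> ?thesis"
  obtain x y where xy: "x \<Rrightarrow> y" using blue_nonempty by auto
  have V: "x \<in> V" "y \<in> V" "x \<noteq> y" using unrelatedD[of x y] xy by auto
  have red: "w \<leadsto> v" if "w \<leadsto> u" "u \<parallel> v" for u v w
  proof -
    have "w \<noteq> v" using that redD[of w u] unrelatedD[of u v] by blast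
    moreover have "\<not> w \<parallel> v" using equiv[of w v u] that redD[of w u] by blast
    moreover have "\<not> v \<leadsto> w" using no that by blast
    ultimately show ?thesis using red_or_unrelated[of w v] red_mem[OF that(1)] unrelatedD[OF that(2)] by blast
  qed
  have red': "v \<leadsto> w" if "u \<leadsto> w" "u \<parallel> v" for u v w
  proof -
    have "w \<noteq> v" using that redD[of u w] unrelatedD[of u v] by blast
    moreover have "\<not> w \<parallel> v" using equiv[of w v u] that redD[of u w] by blast
    moreover have "\<not> w \<leadsto> v" using no that by blast
    ultimately show ?thesis using red_or_unrelated[of w v] red_mem[OF that(1)] unrelatedD[OF that(2)] by blast
  qed
  have swap: "w \<leadsto> x \<longleftrightarrow> w \<leadsto> y" "x \<leadsto> w \<longleftrightarrow> y \<leadsto> w" for w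
    using red[of w x y] red[of w y x] red'[of x w y] red'[of y w x] xy by blast+
  define g where "g = id(x := y, y := x)"
  have g: "g x = y" "g y = x" "\<And>w. w \<noteq> x \<Longrightarrow> w \<noteq> y \<Longrightarrow> g w = w" using V by (auto simp: g_def)
  have "u \<leadsto> v \<longleftrightarrow> g u \<leadsto> g v" for u v
  proof -
    have "(u = x \<or> u = y \<or> u \<noteq> x \<and> u \<noteq> y) \<and> (v = x \<or> v = y \<or> v \<noteq> x \<and> v \<noteq> y)" by blast
    then show ?thesis using swap[of u] swap[of v] swap[of x] swap[of y] g red_irrefl by metis
  qed
  moreover have "bij_betw g V V"
    using V by (auto simp: g_def bij_betw_def inj_on_def)
  ultimately have "aut g" by (simp add: digraph_aut_def digraph_iso_def)
  then have "y \<Rrightarrow> x" using aut_blue[OF _ xy, of g] g by simp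
  then show False using xy blue_asym by blast
qed

locale partitioned_digraph = oriented_digraph +
  assumes unrelated_trans: "x \<parallel> y \<Longrightarrow> y \<parallel> z \<Longrightarrow> x \<noteq> z \<Longrightarrow> x \<parallel> z"
    and forward_path_exists: "\<exists>a b c. a \<leadsto> b \<and> b \<leadsto> c \<and> a \<Rrightarrow> c"
begin

section \<open>Transitivity and the absence of cycles\<close>

lemma path_forward:
  assumes "a \<leadsto> b" "b \<leadsto> c" "a \<parallel> c"
  shows "a \<Rrightarrow> c"
proof -
  obtain x y z where "x \<leadsto> y" "y \<leadsto> z" "x \<Rrightarrow> z" using forward_path_exists by blast
  then show ?thesis using hom_path[of x y z a b c] assms aut_blue by metis
qed

lemma extend_to_path:
  "a \<leadsto> b \<Longrightarrow> \<exists>c. b \<leadsto> c \<and> a \<Rrightarrow> c" "b \<leadsto> c \<Longrightarrow> \<exists>a. a \<leadsto> b \<and> a \<Rrightarrow> c" "a \<Rrightarrow> c \<Longrightarrow> \<exists>b. a \<leadsto> b \<and> b \<leadsto> c"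
proof -
  obtain x y z where xyz: "x \<leadsto> y" "y \<leadsto> z" "x \<Rrightarrow> z" using forward_path_exists by blast
  show "\<exists>c. b \<leadsto> c \<and> a \<Rrightarrow> c" if "a \<leadsto> b" using hom_red[OF xyz(1) that] xyz aut_red aut_blue by metis
  show "\<exists>a. a \<leadsto> b \<and> a \<Rrightarrow> c" if "b \<leadsto> c" using hom_red[OF xyz(2) that] xyz aut_red aut_blue by metis
  show "\<exists>b. a \<leadsto> b \<and> b \<leadsto> c" if "a \<Rrightarrow> c" using hom_blue[OF xyz(3) that] xyz aut_red by metis
qed

lemma red_class:
  assumes "a \<leadsto> b" "b \<parallel> c"
  shows "a \<leadsto> c \<or> c \<leadsto> a"
proof -
  have "a \<noteq> c" using assms redD[of a b] unrelatedD[of b c] by blast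
  moreover have "\<not> a \<parallel> c" using unrelated_trans[of a c b] assms redD[of a b] by blast
  ultimately show ?thesis using red_or_unrelated[of a c] red_mem[OF assms(1)] unrelatedD[OF assms(2)] by blast
qed

text \<open>Move a cycle onto the ends of a forward path \<open>a\<close>, \<open>b\<close>,
  \<open>c\<close>. Whichever way the arc between \<open>b\<close> and the third point
  \<open>d\<close> runs, it makes a red path whose ends are oriented the wrong way.\<close>

lemma no_blue_cycle: "x \<Rrightarrow> y \<Longrightarrow> y \<Rrightarrow> z \<Longrightarrow> \<not> z \<Rrightarrow> x"
proof
  assume cyc: "x \<Rrightarrow> y" "y \<Rrightarrow> z" "z \<Rrightarrow> x"
  obtain a b c where abc: "a \<leadsto> b" "b \<leadsto> c" "a \<Rrightarrow> c" using forward_path_exists by blast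
  obtain d where d: "c \<Rrightarrow> d" "d \<Rrightarrow> a" using hom_blue[OF cyc(1) abc(3)] cyc aut_blue by metis
  have "b \<leadsto> d \<or> d \<leadsto> b" using red_class[OF abc(2), of d] d by blast
  then show False using path_forward[of a b d] path_forward[of d b c] abc d blue_asym by blast
qed

lemma blue_trans: "x \<Rrightarrow> y \<Longrightarrow> y \<Rrightarrow> z \<Longrightarrow> x \<Rrightarrow> z"
  using unrelated_trans[of x y z] no_blue_cycle[of x y z] blue_asym[of x y] by blast

text \<open>Were the arc reversed, \<open>b\<close>, \<open>c\<close>, \<open>a\<close> would be a
  red path and give the blue pair the other direction.\<close>

lemma blue_red:
  assumes "a \<Rrightarrow> b" "b \<leadsto> c"
  shows "a \<leadsto> c"
proof -
  have "\<not> c \<leadsto> a" using path_forward[of b c a] assms blue_asym by blast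
  moreover have "a \<noteq> c" using assms redD[of b c] by blast
  moreover have "\<not> a \<parallel> c" using unrelated_trans[of b a c] assms redD[of b c] by blast
  ultimately show ?thesis using red_or_unrelated[of a c] blue_mem[OF assms(1)] red_mem[OF assms(2)] by blast
qed

lemma red_blue:
  assumes "a \<leadsto> b" "b \<Rrightarrow> c"
  shows "a \<leadsto> c"
  using red_class[of a b c] path_forward[of c a b] assms blue_asym by blast

text \<open>In a red cycle \<open>c \<leadsto> a \<leadsto> b \<leadsto> c\<close> the arc \<open>c \<leadsto> a\<close> lies between two elements \<open>l\<close>, \<open>h\<close> of
  the class of \<open>b\<close>. The four points \<open>l, c, a, h\<close> induce a rigid digraph, so every arc
  enclosed in this way by a class closes up to a red cycle with an element of that class; but
  \<open>l \<leadsto> a\<close> and the class of \<open>c\<close> do not.\<close>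

lemma no_red_cycle:
  assumes "a \<leadsto> b" "b \<leadsto> c"
  shows "\<not> c \<leadsto> a"
proof
  assume ca: "c \<leadsto> a"
  obtain l where l: "l \<leadsto> a" "l \<Rrightarrow> b" using extend_to_path(2)[OF assms(1)] by blast
  obtain h where h: "c \<leadsto> h" "b \<Rrightarrow> h" using extend_to_path(1)[OF assms(2)] by blast
  have lc: "l \<leadsto> c" using blue_red l assms by blast
  have ah: "a \<leadsto> h" using red_blue h assms by blast
  have lh: "l \<Rrightarrow> h" using blue_trans l h by blast
  \<comment> \<open>The class of \<open>c\<close> encloses the arc from \<open>l\<close> to
    \<open>a\<close> between \<open>l'\<close> and \<open>h'\<close>.\<close>
  obtain l' where l': "l' \<leadsto> l" "l' \<Rrightarrow> c" using extend_to_path(2)[OF lc] by blast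
  obtain h' where h': "a \<leadsto> h'" "c \<Rrightarrow> h'" using extend_to_path(1)[OF ca] by blast
  have "l' \<leadsto> a" using blue_red l' ca by blast
  moreover have "l \<leadsto> h'" using red_blue h' lc by blast
  moreover have "l' \<Rrightarrow> h'" using blue_trans l' h' by blast
  \<comment> \<open>Since \<open>g\<close> moves the arc \<open>c\<close>, \<open>a\<close> to
    \<open>l\<close>, \<open>a\<close>, the vertex \<open>g b\<close> closes a red cycle with
    \<open>l\<close> and \<open>a\<close>. It is in the class of \<open>c\<close>, below
    \<open>c\<close> by the red path through \<open>l\<close>, and so has an arc to \<open>a\<close>
    as well.\<close>
  ultimately obtain g where g: "aut g" "g l = l'" "g c = l" "g a = a"
    using hom_diamond[of l c a h l' l a h'] lc l ca h ah lh l' h' by blast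
  have gb: "l' \<Rrightarrow> g b" "a \<leadsto> g b" "g b \<leadsto> l"
    using aut_blue[OF g(1) l(2)] aut_red[OF g(1) assms(1)] aut_red[OF g(1) assms(2)] g by auto
  have "g b \<noteq> c" using gb lc red_asym by blast
  then have "g b \<parallel> c" using unrelated_trans[of "g b" l' c] gb l' by blast
  then have "g b \<Rrightarrow> c" using path_forward gb lc by blast
  then show False using blue_red[of "g b" c a] ca gb red_asym by blast
qed

section \<open>The linear order and its dense classes\<close>

definition precedes :: "'a \<Rightarrow> 'a \<Rightarrow> bool" (infix "\<sqsubset>" 50) where
  "x \<sqsubset> y \<longleftrightarrow> x \<leadsto> y \<or> x \<Rrightarrow> y"

definition same_class :: "'a \<Rightarrow> 'a \<Rightarrow> bool" (infix "\<simeq>" 50) where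
  "x \<simeq> y \<longleftrightarrow> x = y \<or> x \<parallel> y"

lemma precedes_trans: "x \<sqsubset> y \<Longrightarrow> y \<sqsubset> z \<Longrightarrow> x \<sqsubset> z"
proof -
  assume "x \<sqsubset> y" "y \<sqsubset> z"
  then consider "x \<leadsto> y" "y \<leadsto> z" | "x \<leadsto> y" "y \<Rrightarrow> z" | "x \<Rrightarrow> y" "y \<leadsto> z" | "x \<Rrightarrow> y" "y \<Rrightarrow> z"
    by (auto simp: precedes_def)
  then show "x \<sqsubset> z"
  proof cases
    case 1
    have "x \<noteq> z" using 1 red_asym by blast
    then show ?thesis
      using 1 no_red_cycle[OF 1] path_forward[OF 1] red_or_unrelated[of x z] red_mem unfolding precedes_def by blast
  next
    case 2
    then show ?thesis using red_blue[OF 2] by (simp add: precedes_def)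
  next
    case 3
    then show ?thesis using blue_red[OF 3] by (simp add: precedes_def)
  next
    case 4
    then show ?thesis using blue_trans[OF 4] by (simp add: precedes_def)
  qed
qed

lemma precedes_mem: "x \<sqsubset> y \<Longrightarrow> x \<in> V \<and> y \<in> V"
  using red_mem blue_mem unfolding precedes_def by blast

lemma precedes_irrefl: "\<not> x \<sqsubset> x"
  using red_irrefl blue_irrefl unfolding precedes_def by blast

lemma precedes_total: "x \<in> V \<Longrightarrow> y \<in> V \<Longrightarrow> x \<noteq> y \<Longrightarrow> x \<sqsubset> y \<or> y \<sqsubset> x"
  using unrelated_blue[of x y] unfolding precedes_def by blast

lemma same_class_sym: "x \<simeq> y \<Longrightarrow> y \<simeq> x"
  unfolding same_class_def by blast

lemma same_class_trans: "x \<simeq> y \<Longrightarrow> y \<simeq> z \<Longrightarrow> x \<simeq> z"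
  using unrelated_trans[of x y z] unfolding same_class_def by blast

lemma red_iff: "x \<leadsto> y \<longleftrightarrow> x \<sqsubset> y \<and> \<not> x \<simeq> y"
  using redD[of x y] unrelatedD[of x y] unfolding precedes_def same_class_def by blast

lemma blue_iff: "x \<Rrightarrow> y \<longleftrightarrow> x \<sqsubset> y \<and> x \<simeq> y"
  using redD[of x y] blue_neq[of x y] blue_asym[of x y] unfolding precedes_def same_class_def by blast

text \<open>If \<open>x\<close> is outside the class of \<open>z\<close>, then \<open>z\<close>
  itself lies on one side, and completing the arc between them to a path through \<open>x\<close>
  reaches the class on the other.\<close>

lemma class_unbounded:
  assumes "x \<in> V" "z \<in> V"
  shows "\<exists>w. w \<simeq> z \<and> w \<sqsubset> x" "\<exists>w. w \<simeq> z \<and> x \<sqsubset> w"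
proof -
  consider "x \<simeq> z" | "x \<leadsto> z" | "z \<leadsto> x"
    using red_or_unrelated[of x z] assms unfolding same_class_def by blast
  then have "(\<exists>w. w \<simeq> z \<and> w \<sqsubset> x) \<and> (\<exists>w. w \<simeq> z \<and> x \<sqsubset> w)"
  proof cases
    case 1
    obtain u v where "u \<Rrightarrow> x" "x \<Rrightarrow> v" using vertex_degrees assms by blast
    then show ?thesis using 1 same_class_trans blue_iff same_class_sym by metis
  next
    case 2
    then obtain w where "w \<leadsto> x" "w \<Rrightarrow> z" using extend_to_path(2) by blast
    then show ?thesis using 2 red_iff blue_iff same_class_def by metis
  next
    case 3
    then obtain w where "x \<leadsto> w" "z \<Rrightarrow> w" using extend_to_path(1) by blast
    then show ?thesis using 3 red_iff blue_iff same_class_def by metis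
  qed
  then show "\<exists>w. w \<simeq> z \<and> w \<sqsubset> x" "\<exists>w. w \<simeq> z \<and> x \<sqsubset> w" by blast+
qed

text \<open>Provides the diamonds to which \<open>hom_diamond\<close> applies.\<close>

lemma enclose_arc:
  assumes "x \<leadsto> y" "z \<in> V" "\<not> z \<simeq> x" "\<not> z \<simeq> y"
  shows "\<exists>l h. l \<simeq> z \<and> l \<leadsto> x \<and> l \<leadsto> y \<and> x \<leadsto> h \<and> y \<leadsto> h \<and> l \<Rrightarrow> h"
proof -
  have V: "x \<in> V" "y \<in> V" using assms red_mem by auto
  obtain l h where lh: "l \<simeq> z" "l \<sqsubset> x" "h \<simeq> z" "y \<sqsubset> h"
    using class_unbounded(1)[OF V(1) assms(2)] class_unbounded(2)[OF V(2) assms(2)] by blast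
  have "x \<sqsubset> y" using assms red_iff by blast
  then have "l \<sqsubset> y" "x \<sqsubset> h" "l \<sqsubset> h" using lh precedes_trans by blast+
  moreover have "\<not> l \<simeq> x" "\<not> l \<simeq> y" "\<not> x \<simeq> h" "\<not> y \<simeq> h"
    using lh assms(3,4) same_class_trans same_class_sym by meson+
  moreover have "l \<simeq> h" using lh same_class_trans same_class_sym by meson
  ultimately show ?thesis using lh red_iff blue_iff by blast
qed

text \<open>Around \<open>z\<close> there is an arc from \<open>x'\<close> to \<open>y'\<close>
  between the classes of \<open>x\<close> and \<open>y\<close>. The class of \<open>z\<close>
  encloses both arcs, so an automorphism matches the two diamonds, preserves that class and moves
  \<open>z\<close> between \<open>x\<close> and \<open>y\<close>.\<close>

lemma class_dense_third:
  assumes "x \<leadsto> y" "z \<in> V" "\<not> z \<simeq> x" "\<not> z \<simeq> y"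
  shows "\<exists>w. w \<simeq> z \<and> x \<sqsubset> w \<and> w \<sqsubset> y"
proof -
  have V: "x \<in> V" "y \<in> V" using assms red_mem by auto
  obtain x' y' where x': "x' \<simeq> x" "x' \<sqsubset> z" and y': "y' \<simeq> y" "z \<sqsubset> y'"
    using class_unbounded(1)[OF assms(2) V(1)] class_unbounded(2)[OF assms(2) V(2)] by blast
  have "\<not> x \<simeq> y" using assms red_iff by blast
  then have ns: "\<not> x' \<simeq> z" "\<not> z \<simeq> y'" "\<not> x' \<simeq> y'" "\<not> z \<simeq> x'"
    using x' y' assms(3,4) same_class_trans same_class_sym by meson+
  then have r: "x' \<leadsto> z" "z \<leadsto> y'" "x' \<leadsto> y'" using x' y' precedes_trans red_iff by blast+
  obtain l h where lh: "l \<simeq> z" "l \<leadsto> x" "l \<leadsto> y" "x \<leadsto> h" "y \<leadsto> h" "l \<Rrightarrow> h"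
    using enclose_arc[OF assms] by blast
  obtain l' h' where lh': "l' \<simeq> z" "l' \<leadsto> x'" "l' \<leadsto> y'" "x' \<leadsto> h'" "y' \<leadsto> h'" "l' \<Rrightarrow> h'"
    using enclose_arc[OF r(3) assms(2) ns(4,2)] by blast
  obtain g where g: "aut g" "g l' = l" "g x' = x" "g y' = y"
    using hom_diamond[of l' x' y' h' l x y h] lh lh' r assms(1) by blast
  \<comment> \<open>The invariance of unrelatedness then places \<open>g z\<close> in the class of
    \<open>g l'\<close>, which is \<open>l\<close>.\<close>
  have "l' \<noteq> z" using lh'(2) r(1) red_asym by blast
  then have "l' \<parallel> z" using lh'(1) by (auto simp: same_class_def)
  then have "g l' \<parallel> g z" using aut_blue[OF g(1)] by blast
  then have "g z \<simeq> l" using g by (auto simp: same_class_def)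
  moreover have "x \<leadsto> g z" "g z \<leadsto> y" using aut_red[OF g(1)] r g by metis+
  ultimately show ?thesis using lh(1) same_class_trans red_iff by blast
qed

text \<open>If the class is that of an end, shrink the arc: an automorphism taking a longer arc,
  with that end replaced by \<open>t\<close> further out in its class, to the arc itself moves the
  old end inside.\<close>

lemma class_dense_arc:
  assumes xy: "x \<leadsto> y" and z: "z \<in> V"
  shows "\<exists>w. w \<simeq> z \<and> x \<sqsubset> w \<and> w \<sqsubset> y"
proof -
  have V: "x \<in> V" "y \<in> V" using xy red_mem by auto
  consider "z \<simeq> x" | "z \<simeq> y" | "\<not> z \<simeq> x" "\<not> z \<simeq> y" by blast
  then show ?thesis
  proof cases
    case 1
    obtain t where t: "t \<Rrightarrow> x" using vertex_degrees V by blast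
    obtain g where g: "aut g" "g t = x" "g y = y" using hom_red[OF blue_red[OF t xy] xy] by blast
    have "x \<Rrightarrow> g x" "g x \<leadsto> y" using aut_blue[OF g(1) t] aut_red[OF g(1) xy] g by auto
    then show ?thesis using 1 same_class_trans same_class_sym red_iff blue_iff by meson
  next
    case 2
    obtain t where t: "y \<Rrightarrow> t" using vertex_degrees V by blast
    obtain g where g: "aut g" "g x = x" "g t = y" using hom_red[OF red_blue[OF xy t] xy] by blast
    have "x \<leadsto> g y" "g y \<Rrightarrow> y" using aut_blue[OF g(1) t] aut_red[OF g(1) xy] g by auto
    then show ?thesis using 2 same_class_trans same_class_sym red_iff blue_iff by meson
  next
    case 3
    then show ?thesis using class_dense_third[OF xy z] by blast
  qed
qed

lemma class_dense:
  assumes "x \<sqsubset> y" "z \<in> V"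
  shows "\<exists>w. w \<simeq> z \<and> x \<sqsubset> w \<and> w \<sqsubset> y"
proof (cases "x \<leadsto> y")
  case False
  then obtain t where t: "x \<leadsto> t" "t \<leadsto> y" using assms(1) extend_to_path(3) precedes_def by blast
  then obtain w where "w \<simeq> z" "x \<sqsubset> w" "w \<sqsubset> t" using class_dense_arc[OF t(1) assms(2)] by blast
  moreover have "t \<sqsubset> y" using t red_iff by blast
  ultimately show ?thesis using precedes_trans by blast
qed (use class_dense_arc assms in blast)

lemma precedes_dense_unbounded: "dense_unbounded_order V (\<sqsubset>)"
  unfolding dense_unbounded_order_def
proof (intro conjI ballI impI)
  show "V \<noteq> {}" using red_nonempty red_mem by auto
  show "\<exists>z\<in>V. x \<sqsubset> z \<and> z \<sqsubset> y" if "x \<sqsubset> y" for x y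
    using class_dense[OF that, of x] precedes_mem that by blast
  show "\<exists>y\<in>V. x \<sqsubset> y" "\<exists>y\<in>V. y \<sqsubset> x" if "x \<in> V" for x
    using class_unbounded[OF that that] precedes_mem by blast+
  show "x \<sqsubset> z" if "x \<sqsubset> y" "y \<sqsubset> z" for x y z using precedes_trans that by blast
qed (use precedes_irrefl precedes_total in auto)

section \<open>The isomorphism onto the rationals\<close>

lemma is_R:
  assumes count: "countable V"
  shows "\<exists>n::enat. 2 \<le> n \<and> is_R n V R"
proof -
  obtain f where f: "bij_betw f V (UNIV :: rat set)"
    and f_less: "\<And>x y. x \<in> V \<Longrightarrow> y \<in> V \<Longrightarrow> x \<sqsubset> y \<longleftrightarrow> f x < f y"
    by (rule countable_dense_orders_isomorphic[OF precedes_dense_unbounded count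
          dense_unbounded_order_rat countableI_type]) blast
  have inj: "inj_on f V" and surj: "f ` V = UNIV" using f by (auto simp: bij_betw_def)
  define cl where "cl x = {y \<in> V. y \<simeq> x}" for x
  have cl_eq: "cl x = cl y \<longleftrightarrow> x \<simeq> y" if "x \<in> V" "y \<in> V" for x y
  proof
    assume "cl x = cl y"
    moreover have "x \<in> cl x" using that by (simp add: cl_def same_class_def)
    ultimately show "x \<simeq> y" by (simp add: cl_def)
  next
    assume "x \<simeq> y"
    then show "cl x = cl y" unfolding cl_def using same_class_trans same_class_sym by blast
  qed
  define C where "C = cl ` V"
  have countC: "countable C" using count by (simp add: C_def)
  obtain a b where ab: "a \<leadsto> b" using red_nonempty by auto
  have two: "cl a \<in> C" "cl b \<in> C" "cl a \<noteq> cl b" using ab red_mem[OF ab] cl_eq red_iff by (auto simp: C_def)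
  \<comment> \<open>\<open>n\<close> is the number of classes, at least 2 because the ends of an arc
    lie in different ones; infinitely many classes are enumerated without repetition.\<close>
  obtain n :: enat and e where n: "2 \<le> n" and e: "bij_betw e {i. enat i < n} C"
  proof (cases "finite C")
    case True
    obtain e where e: "bij_betw e {0..<card C} C" using ex_bij_betw_nat_finite[OF True] by blast
    have "card {cl a, cl b} \<le> card C" by (rule card_mono) (use True two in auto)
    then have "2 \<le> card C" using two(3) by simp
    then have "2 \<le> enat (card C)" by (simp add: numeral_eq_enat)
    moreover have "{i. enat i < enat (card C)} = {0..<card C}" by auto
    ultimately show thesis using e that by metis
  next
    case False
    have "bij_betw (from_nat_into C) {i. enat i < \<infinity>} C"
      using bij_betw_from_nat_into[OF countC False] by simp
    then show thesis using that[of \<infinity>] by simp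
  qed
  let ?I = "{i. enat i < n}"
  have eC: "\<exists>z\<in>V. e i = cl z" if "enat i < n" for i
    using bij_betwE[OF e] that by (auto simp: C_def)
  have e_ex: "\<exists>i. enat i < n \<and> e i = cl z" if "z \<in> V" for z
  proof -
    have "cl z \<in> e ` ?I" using bij_betw_imp_surj_on[OF e] that by (simp add: C_def)
    then show ?thesis by auto
  qed
  define Q where "Q i = f ` e i" for i
  have Q_iff: "f x \<in> Q i \<longleftrightarrow> cl x = e i" if "x \<in> V" "enat i < n" for x i
  proof -
    obtain z where z: "z \<in> V" "e i = cl z" using eC \<open>enat i < n\<close> by blast
    have "f x \<in> Q i \<longleftrightarrow> x \<in> cl z"
      unfolding Q_def z(2) using inj \<open>x \<in> V\<close> by (auto simp: cl_def dest: inj_onD)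
    then show ?thesis using cl_eq[OF \<open>x \<in> V\<close> z(1)] z \<open>x \<in> V\<close> by (simp add: cl_def)
  qed
  have Q_dense: "dense_in_rat (Q i)" if "enat i < n" for i
    unfolding dense_in_rat_def
  proof (intro allI impI)
    fix p q :: rat assume "p < q"
    obtain x y where xy: "x \<in> V" "y \<in> V" "p = f x" "q = f y" using surj by (metis UNIV_I imageE)
    obtain z where z: "z \<in> V" "e i = cl z" using eC \<open>enat i < n\<close> by blast
    have "x \<sqsubset> y" using f_less xy \<open>p < q\<close> by blast
    then obtain w where w: "w \<simeq> z" "x \<sqsubset> w" "w \<sqsubset> y" using class_dense z by blast
    have "w \<in> V" using w precedes_mem by blast
    then have "f w \<in> Q i" using Q_iff cl_eq z w \<open>enat i < n\<close> by metis
    then show "\<exists>c\<in>Q i. p < c \<and> c < q" using f_less xy w \<open>w \<in> V\<close> by blast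
  qed
  have disj: "Q i \<inter> Q j = {}" if "enat i < n" "enat j < n" "i \<noteq> j" for i j
  proof -
    have "e i \<noteq> e j" using e that by (auto simp: bij_betw_def dest: inj_onD)
    then show ?thesis using Q_iff that surj by (metis UNIV_I disjoint_iff imageE)
  qed
  have "dense_codense_partition n Q"
    unfolding dense_codense_partition_def
  proof (intro conjI allI impI)
    show "disjoint_family_on Q ?I" using disj by (auto simp: disjoint_family_on_def)
    show "(\<Union>i\<in>?I. Q i) = UNIV"
    proof (intro set_eqI iffI UNIV_I)
      fix p :: rat
      obtain x where "x \<in> V" "p = f x" using surj by (metis UNIV_I imageE)
      then show "p \<in> (\<Union>i\<in>?I. Q i)" using e_ex[of x] Q_iff[of x] by auto
    qed
    fix i assume i: "enat i < n"
    show "dense_in_rat (Q i)" using Q_dense i .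
    \<comment> \<open>As there are two classes, some other part \<open>Q j\<close> lies in the
      complement, and its density is enough.\<close>
    obtain ia ib where iab: "enat ia < n" "enat ib < n" "e ia = cl a" "e ib = cl b"
      using e_ex red_mem[OF ab] by metis
    then obtain j where j: "enat j < n" "j \<noteq> i" using two(3) by metis
    have "Q j \<subseteq> - Q i" using disj[OF i j(1)] j(2) by blast
    then show "dense_in_rat (- Q i)" using Q_dense[OF j(1)] unfolding dense_in_rat_def by blast
  qed
  moreover have "digraph_iso V R UNIV (R_rel n Q) f"
    unfolding digraph_iso_def
  proof (intro conjI ballI)
    show "bij_betw f V UNIV" by (rule f)
    fix x y assume xy: "x \<in> V" "y \<in> V"
    have "(\<exists>i. enat i < n \<and> f x \<in> Q i \<and> f y \<in> Q i) \<longleftrightarrow> x \<simeq> y"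
      using Q_iff xy e_ex[of x] cl_eq[OF xy] by metis
    then show "x \<leadsto> y \<longleftrightarrow> (f x, f y) \<in> R_rel n Q"
      unfolding R_rel_def using red_iff[of x y] f_less[OF xy] by blast
  qed
  ultimately show ?thesis using n unfolding is_R_def isomorphic_digraphs_def by blast
qed

end

section \<open>The case distinction\<close>

text \<open>If no arc has a vertex unrelated to both ends, unrelatedness is transitive on distinct
  vertices. In either case \<open>B\<close> or its converse meets the orientation required by the
  locale.\<close>

lemma (in oriented_digraph) classification:
  assumes "countable V" "infinite V"
  shows "is_T4 V R \<or> (\<exists>n::enat. 2 \<le> n \<and> is_R n V R)"
proof (cases "\<exists>a b c. a \<leadsto> b \<and> a \<parallel> c \<and> b \<parallel> c")
  case True
  then obtain a b c where abc: "a \<leadsto> b" "a \<parallel> c" "b \<parallel> c" by blast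
  then consider "b \<Rrightarrow> c" "c \<Rrightarrow> a" | "a \<Rrightarrow> c" "c \<Rrightarrow> b"
    using no_common_successor[of a b c] no_common_predecessor[of a b c] by blast
  then have "circular_digraph V R B \<or> circular_digraph V R (B\<inverse>)"
  proof cases
    case 1
    then have "circular_digraph V R B" using abc(1) assms(2) by unfold_locales blast+
    then show ?thesis ..
  next
    case 2
    then have "(a, b) \<in> R \<and> (b, c) \<in> B\<inverse> \<and> (c, a) \<in> B\<inverse>" using abc(1) by simp
    then have "circular_digraph V R (B\<inverse>)"
      by (intro circular_digraph.intro circular_digraph_axioms.intro reverse_blue assms(2)) blast
    then show ?thesis ..
  qed
  then show ?thesis using circular_digraph.is_T4[OF _ assms(1)] by blast
next
  case False
  have equiv: "x \<parallel> z" if "x \<parallel> y" "y \<parallel> z" "x \<noteq> z" for x y z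
    using False red_or_unrelated[of x z] unrelatedD[OF that(1)] unrelatedD[OF that(2)] that by blast
  have "\<exists>a b c. a \<leadsto> b \<and> b \<leadsto> c \<and> a \<parallel> c" by (rule path_exists) (rule equiv)
  then obtain a b c where abc: "a \<leadsto> b" "b \<leadsto> c" "a \<parallel> c" by blast
  have "partitioned_digraph V R B \<or> partitioned_digraph V R (B\<inverse>)"
  proof (cases "a \<Rrightarrow> c")
    case True
    have "partitioned_digraph V R B" by unfold_locales (use equiv abc True in blast)+
    then show ?thesis ..
  next
    case False
    have "partitioned_digraph V R (B\<inverse>)"
    proof (intro partitioned_digraph.intro partitioned_digraph_axioms.intro reverse_blue)
      show "(x, z) \<in> B\<inverse> \<or> (z, x) \<in> B\<inverse>"
        if "(x, y) \<in> B\<inverse> \<or> (y, x) \<in> B\<inverse>" "(y, z) \<in> B\<inverse> \<or> (z, y) \<in> B\<inverse>" "x \<noteq> z" for x y z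
        using equiv[of x y z] that by simp blast
      have "(a, b) \<in> R \<and> (b, c) \<in> R \<and> (a, c) \<in> B\<inverse>" using abc False by simp
      then show "\<exists>a b c. (a, b) \<in> R \<and> (b, c) \<in> R \<and> (a, c) \<in> B\<inverse>" by blast
    qed
    then show ?thesis ..
  qed
  then show ?thesis using partitioned_digraph.is_R[OF _ assms(1)] by blast
qed

theorem theorem1p4:
  fixes V :: "'a set" and R :: "'a rel"
  assumes "a_digraph V R"
    and "countable V" and "infinite V"
    and "set_homogeneous V R"
    and "\<not> k_homogeneous 2 V R"
  shows "is_T4 V R \<or> (\<exists>n::enat. 2 \<le> n \<and> n \<le> \<infinity> \<and> is_R n V R)"
proof -
  obtain B where "oriented_digraph V R B" using oriented_digraph_exists[OF assms(1,4,5)] by blast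
  from oriented_digraph.classification[OF this assms(2,3)] show ?thesis by auto
qed

end
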